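(* Let $\tau\in\mathbb{Z}$ and let $U^\tau$ be the unknot with framing $\tau$. (1) The extremal $A$-polynomials of $U^\tau$ are (up to multiplication by a nonzero constant and a monomial in $x,y$) $$\mathcal{A}^+_{U^\tau}(x,y)=(-1)^\tau(y^2-1)-xy^{2\tau+2},\qquad \mathcal{A}^-_{U^\tau}(x,y)=(-1)^\tau(y^2-1)+xy^{2\tau}.$$ (2) For every integer $r\ge1$ the extremal BPS invariants of $U^\tau$ are $$b_r^+(U^\tau)=\frac1{r^2}\sum_{d\mid r}\mu\left(\frac rd\right)(-1)^{d\tau}\binom{d(\tau+1)-1}{d-1},$$ $$b_r^-(U^\tau)=\frac1{r^2}\sum_{d\mid r}\mu\left(\frac rd\right)(-1)^{d(\tau+1)}\binom{d\tau-1}{d-1},$$ where $\mu$ is the Möbius function.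
   Context: Binomial coefficients: for $n<0$ and $k\ge0$, $\binom nk=(-1)^k\binom{-n+k-1}{k}$. Colored HOMFLYPT invariants of the unknot (symmetric representations): $H_0(U;q,a)=1$ and $$H_n(U;q,a)=\prod_{k=1}^{n}\frac{a^{\frac12}q^{\frac{k-1}{2}}-a^{-\frac12}q^{-\frac{k-1}{2}}}{q^{\frac k2}-q^{-\frac k2}}\qquad(n\ge1).$$ The framed invariants are $\mathcal{H}_n(U^\tau;q,a)=(-1)^{n\tau}q^{\frac{n(n-1)}{2}\tau}H_n(U;q,a)$. Dual $A$-polynomial: let $M,L$ act on sequences $(f_n)_{n\ge0}$ by $Mf_n=q^{n/2}f_n$, $Lf_n=f_{n+1}$, so $LM=q^{1/2}ML$. Let $\hat A(M,L,a,q)=\sum_{l=0}^{d}a_l(M,a,q)L^l$ be a nonzero operator of minimal order $d$ in $L$ annihilating $(\mathcal{H}_n(U^\tau;q,a))_n$ for all but finitely many $n$, with coefficients $a_l$ Laurent polynomials in $M,a^{1/2},q^{1/2}$ (over $\mathbb{Q}$) having no common non-unit factor. Put $A_{U^\tau}(M,L,a)=\hat A(M,L,a,1)$ (i.e. $q^{1/2}=1$). The dual $A$-polynomial is $\mathcal{A}_{U^\tau}(x,y,a)=A_{U^\tau}(y,x^{-1},a)$, considered up to multiplication by a nonzero constant and a monomial in $x,y,a^{1/2}$. BPS invariants: define $\mathfrak{f}_r(U^\tau;a,q)$, $r\ge1$, by $$\sum_{r\ge0}\mathcal{H}_r(U^\tau;q,a)x^r=\exp\left(\sum_{d\ge1}\sum_{r\ge1}\frac1d\,\mathfrak{f}_r(U^\tau;a^d,q^d)x^{rd}\right).$$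 Standing assumption (Ooguri–Vafa form): $\mathfrak{f}_r$ is a finite sum $\mathfrak{f}_r(U^\tau;a,q)=\sum_{i,j\in\mathbb{Z}}\frac{N_{r,i,j}(U^\tau)a^{i/2}q^{j/2}}{q^{1/2}-q^{-1/2}}$ with $N_{r,i,j}(U^\tau)\in\mathbb{Z}$; put $b_{r,i}(U^\tau)=\sum_jN_{r,i,j}(U^\tau)$. Extremal objects: the exponents of $a^{1/2}$ occurring in $\mathcal{H}_r(U^\tau;q,a)$ have minimum $rc_-$ and maximum $rc_+$ with $c_\pm=\pm1$. The extremal BPS invariants are $b_r^\pm(U^\tau)=b_{r,rc_\pm}(U^\tau)$. The extremal $A$-polynomial $\mathcal{A}^\pm_{U^\tau}(x,y)$ is the distinguished irreducible factor of $\mathcal{A}_{U^\tau}(xa^{-c_\pm/2},y,a)|_{a^{\mp1}\to0}$ (after multiplying by the power of $a$ for which the limit exists and is nonzero) that determines the extremal BPS invariants, i.e. that vanishes at $y=y_\pm(x)$, where $y_\pm(x)\in1+x\mathbb{Q}[[x]]$ is the power series with $$x\frac{y_\pm'(x)}{y_\pm(x)}=\frac12\sum_{r\ge1}r^2b_r^\pm(U^\tau)\frac{x^r}{1-x^r}.$$ It is considered up to multiplication by a nonzero constant and a monomial in $x,y$. *)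

theory Defs
  imports
    "HOL-Computational_Algebra.Computational_Algebra"
    "HOL-Library.Poly_Mapping"
    "HOL-Library.Product_Plus"
begin

text \<open>
  In comments, \<open>s\<close> stands for \<open>q\<^sup>1\<^sup>/\<^sup>2\<close> and \<open>t\<close> for \<open>a\<^sup>1\<^sup>/\<^sup>2\<close>. The invariants live in the field
  of rational functions in \<open>s\<close> and \<open>t\<close> over the rationals, represented as the fraction field of
  the polynomial ring with inner variable \<open>s\<close> and outer variable \<open>t\<close>.
\<close>

type_synonym ratfun = "rat poly poly fract"

definition q_half :: ratfun where
  "q_half = to_fract [:[:0, 1:]:]"

definition a_half :: ratfun where
  "a_half = to_fract [:0, 1:]"


section \<open>Colored HOMFLYPT invariants of the framed unknot\<close>

definition unknot_H :: "nat \<Rightarrow> ratfun" where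
  "unknot_H n =
     (\<Prod>k=1..n. (a_half * q_half powi (int k - 1) - inverse a_half * q_half powi (- (int k - 1)))
              / (q_half powi int k - q_half powi (- int k)))"

definition framed_H :: "int \<Rightarrow> nat \<Rightarrow> ratfun" where
  "framed_H \<tau> n = 
     (-1) powi (int n * \<tau>) * q_half powi (int n * (int n - 1) * \<tau>) * unknot_H n"


section \<open>BPS invariants\<close>

definition adams_poly :: "nat \<Rightarrow> rat poly poly \<Rightarrow> rat poly poly" where
  "adams_poly d p = pcompose (map_poly (\<lambda>c. pcompose c (monom 1 d)) p) (monom 1 d)"

text \<open>
  The substitution \<open>f(a, q) \<mapsto> f(a\<^sup>d, q\<^sup>d)\<close>, that is \<open>s \<mapsto> s\<^sup>d\<close>, \<open>t \<mapsto> t\<^sup>d\<close>, for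
  \<open>d \<ge> 1\<close>; well-defined by lemma \<open>adams_Fract\<close>.
\<close>

definition adams :: "nat \<Rightarrow> ratfun \<Rightarrow> ratfun" where
  "adams d f = (THE g. \<exists>p p'. p' \<noteq> 0 \<and> f = Fract p p' \<and>
                             g = Fract (adams_poly d p) (adams_poly d p'))"

lemma adams_poly_mult: "adams_poly d (p * p') = adams_poly d p * adams_poly d p'"
proof -
  let ?h = "\<lambda>c::rat poly. pcompose c (monom 1 d)"
  have "map_poly ?h (p * p') = map_poly ?h p * map_poly ?h p'"
    by (rule poly_eqI)
       (simp add: coeff_map_poly coeff_mult pcompose_sum pcompose_mult)
  then show ?thesis
    by (simp add: adams_poly_def pcompose_mult)
qed

lemma adams_poly_eq_0_iff: "d \<ge> 1 \<Longrightarrow> adams_poly d p = 0 \<longleftrightarrow> p = 0"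
proof -
  assume d: "d \<ge> 1"
  have pc0: "pcompose r (monom 1 d) = 0 \<longleftrightarrow> r = 0" for r :: "'a::idom poly"
    by (rule iffI, rule pcompose_eq_0) (use d in \<open>auto simp: degree_monom_eq\<close>)
  have "map_poly (\<lambda>c. pcompose c (monom 1 d)) p = 0 \<longleftrightarrow> (\<forall>n. coeff p n = 0)"
    by (subst poly_eq_iff) (simp add: coeff_map_poly pc0)
  then show ?thesis
    unfolding adams_poly_def pc0 by (simp add: poly_eq_iff[of p 0])
qed

lemma adams_Fract:
  assumes "d \<ge> 1" "p' \<noteq> 0"
  shows "adams d (Fract p p') = Fract (adams_poly d p) (adams_poly d p')"
  unfolding adams_def
proof (rule the_equality)
  fix g
  assume "\<exists>r r'. r' \<noteq> 0 \<and> Fract p p' = Fract r r' \<and>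
                 g = Fract (adams_poly d r) (adams_poly d r')"
  then obtain r r' where r: "r' \<noteq> 0" "Fract p p' = Fract r r'"
    and g: "g = Fract (adams_poly d r) (adams_poly d r')" by blast
  from r assms have "p * r' = r * p'" by (simp add: eq_fract)
  then have "adams_poly d p * adams_poly d r' = adams_poly d r * adams_poly d p'"
    by (metis adams_poly_mult)
  then show "g = Fract (adams_poly d p) (adams_poly d p')"
    using g r assms by (simp add: eq_fract adams_poly_eq_0_iff)
qed (use assms in blast)

text \<open>
  The formal infinite sum of the power series \<open>F 1, F 2, \<dots>\<close>, where \<open>F r\<close> is divisible by
  \<open>fps_X ^ r\<close>: under this condition only \<open>F 1, \<dots>, F n\<close> contribute to the \<open>n\<close>-th coefficient.
\<close>

definition formal_sum :: "(nat \<Rightarrow> 'a::comm_monoid_add fps) \<Rightarrow> 'a fps" where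
  "formal_sum F = Abs_fps (\<lambda>n. \<Sum>r=1..n. fps_nth (F r) n)"

definition BPS_functions :: "int \<Rightarrow> (nat \<Rightarrow> ratfun) \<Rightarrow> bool" where
  "BPS_functions \<tau> f \<longleftrightarrow>
     Abs_fps (framed_H \<tau>) =
       fps_compose (fps_exp 1)
         (formal_sum (\<lambda>d. formal_sum (\<lambda>r.
            fps_const (1 / of_nat d * adams d (f r)) * fps_X ^ (r * d))))"

text \<open>
  The Ooguri--Vafa form of the functions \<open>f r\<close>; \<open>N r i j\<close> is the coefficient of
  \<open>a\<^sup>i\<^sup>/\<^sup>2 q\<^sup>j\<^sup>/\<^sup>2\<close>.
\<close>

definition Ooguri_Vafa_form ::
    "(nat \<Rightarrow> ratfun) \<Rightarrow> (nat \<Rightarrow> int \<Rightarrow> int \<Rightarrow> int) \<Rightarrow> bool" where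
  "Ooguri_Vafa_form f N \<longleftrightarrow> (\<forall>r\<ge>1.
     finite {(i, j). N r i j \<noteq> 0} \<and>
     f r = (\<Sum>(i, j)\<in>{(i, j). N r i j \<noteq> 0}.
              of_int (N r i j) * a_half powi i * q_half powi j / (q_half - inverse q_half)))"

definition BPS_invariants :: "int \<Rightarrow> (nat \<Rightarrow> int \<Rightarrow> int \<Rightarrow> int) \<Rightarrow> bool" where
  "BPS_invariants \<tau> N \<longleftrightarrow> (\<exists>f. BPS_functions \<tau> f \<and> Ooguri_Vafa_form f N)"

definition bps :: "(nat \<Rightarrow> int \<Rightarrow> int \<Rightarrow> int) \<Rightarrow> nat \<Rightarrow> int \<Rightarrow> int" where
  "bps N r i = (\<Sum>j\<in>{j. N r i j \<noteq> 0}. N r i j)"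

text \<open>
  The parameter \<open>c\<close> is \<open>1\<close> for the maximal and \<open>- 1\<close> for the minimal case: these are the values
  of \<open>c\<^sub>+\<close> and \<open>c\<^sub>-\<close> for the unknot, the exponents of \<open>a\<^sup>1\<^sup>/\<^sup>2\<close> in the
  \<open>r\<close>-th invariant ranging from \<open>- r\<close> to \<open>r\<close> for every framing.
\<close>

definition extremal_BPS :: "(nat \<Rightarrow> int \<Rightarrow> int \<Rightarrow> int) \<Rightarrow> int \<Rightarrow> nat \<Rightarrow> int" where
  "extremal_BPS N c r = bps N r (int r * c)"


section \<open>Laurent polynomials\<close>

text \<open>Laurent polynomials are the elements of the group rings of \<open>\<int>\<^sup>2\<close> and \<open>\<int>\<^sup>3\<close>.\<close>

type_synonym laurent2 = "(int \<times> int) \<Rightarrow>\<^sub>0 rat"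
type_synonym laurent3 = "(int \<times> int \<times> int) \<Rightarrow>\<^sub>0 rat"

text \<open>Replacing each monomial with exponent \<open>e\<close> by the monomial with exponent \<open>\<phi> e\<close>.\<close>

definition monomial_subst :: "('e \<Rightarrow> 'e') \<Rightarrow> ('e \<Rightarrow>\<^sub>0 rat) \<Rightarrow> ('e' \<Rightarrow>\<^sub>0 rat)" where
  "monomial_subst \<phi> p =
     (\<Sum>e\<in>Poly_Mapping.keys p. Poly_Mapping.single (\<phi> e) (Poly_Mapping.lookup p e))"

text \<open>Equality up to a nonzero constant and a monomial.\<close>

definition monomial_equiv ::
    "('e::comm_monoid_add \<Rightarrow>\<^sub>0 rat) \<Rightarrow> ('e \<Rightarrow>\<^sub>0 rat) \<Rightarrow> bool" where
  "monomial_equiv p p' \<longleftrightarrow> (\<exists>c e. c \<noteq> 0 \<and> p = Poly_Mapping.single e c * p')"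

definition lconst :: "rat \<Rightarrow> laurent2" where
  "lconst c = Poly_Mapping.single (0, 0) c"

definition xpow :: "int \<Rightarrow> laurent2" where
  "xpow i = Poly_Mapping.single (i, 0) 1"

definition ypow :: "int \<Rightarrow> laurent2" where
  "ypow j = Poly_Mapping.single (0, j) 1"


section \<open>The dual A-polynomial\<close>

text \<open>
  An operator \<open>\<Sum>\<^sub>l a\<^sub>l L\<^sup>l\<close> is represented by the polynomial (used only as a list of coefficients)
  whose \<open>l\<close>-th coefficient \<open>a\<^sub>l\<close> is a Laurent polynomial; the exponents \<open>(i, j, k)\<close> refer to
  \<open>M\<^sup>i t\<^sup>j s\<^sup>k\<close>. The order in \<open>L\<close> is then the degree. Since \<open>M\<close> multiplies the \<open>n\<close>-th entry of a
  sequence by \<open>s\<^sup>n\<close>, a coefficient acts on that entry through its value at \<open>M = s\<^sup>n\<close>.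
\<close>

type_synonym operator = "laurent3 poly"

definition coeff_at :: "laurent3 \<Rightarrow> nat \<Rightarrow> ratfun" where
  "coeff_at p n = (\<Sum>(i, j, k)\<in>Poly_Mapping.keys p.
     of_rat (Poly_Mapping.lookup p (i, j, k)) * (q_half ^ n) powi i * a_half powi j * q_half powi k)"

definition op_apply :: "operator \<Rightarrow> (nat \<Rightarrow> ratfun) \<Rightarrow> nat \<Rightarrow> ratfun" where
  "op_apply A f n = (\<Sum>l\<le>degree A. coeff_at (coeff A l) n * f (n + l))"

definition annihilates :: "operator \<Rightarrow> (nat \<Rightarrow> ratfun) \<Rightarrow> bool" where
  "annihilates A f \<longleftrightarrow> finite {n. op_apply A f n \<noteq> 0}"

definition quantum_A_polynomial :: "int \<Rightarrow> operator \<Rightarrow> bool" where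
  "quantum_A_polynomial \<tau> A \<longleftrightarrow>
     A \<noteq> 0 \<and> annihilates A (framed_H \<tau>) \<and>
     (\<forall>B. B \<noteq> 0 \<and> annihilates B (framed_H \<tau>) \<longrightarrow> degree A \<le> degree B) \<and>
     (\<forall>p. (\<forall>l. p dvd coeff A l) \<longrightarrow> p dvd 1)"

text \<open>The specialization at \<open>s = 1\<close>; the exponents \<open>(i, l, j)\<close> refer to \<open>M\<^sup>i L\<^sup>l t\<^sup>j\<close>.\<close>

definition classical_limit :: "operator \<Rightarrow> laurent3" where
  "classical_limit A = (\<Sum>l\<le>degree A. monomial_subst (\<lambda>(i, j, k). (i, int l, j)) (coeff A l))"

text \<open>Putting \<open>M = y\<close> and \<open>L = x\<^sup>-\<^sup>1\<close>; the exponents \<open>(i, j, k)\<close> of the dual refer to \<open>x\<^sup>i y\<^sup>j t\<^sup>k\<close>.\<close>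

definition dual_A_polynomial :: "int \<Rightarrow> laurent3 \<Rightarrow> bool" where
  "dual_A_polynomial \<tau> D \<longleftrightarrow>
     (\<exists>A. quantum_A_polynomial \<tau> A \<and>
          monomial_equiv D (monomial_subst (\<lambda>(i, l, j). (- l, i, j)) (classical_limit A)))"


section \<open>Extremal A-polynomials\<close>

text \<open>
  The substitution \<open>x \<mapsto> x a\<^sup>-\<^sup>c\<^sup>/\<^sup>2 = x t\<^sup>-\<^sup>c\<close>.
\<close>

definition rescale_x :: "int \<Rightarrow> laurent3 \<Rightarrow> laurent3" where
  "rescale_x c = monomial_subst (\<lambda>(i, j, k). (i, j, k - c * i))"

text \<open>
  The limit for \<open>a\<^sup>-\<^sup>1 \<rightarrow> 0\<close> (\<open>c = 1\<close>) or \<open>a \<rightarrow> 0\<close> (\<open>c = - 1\<close>) after multiplication by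
  the power of \<open>t\<close> for which it exists and is nonzero: this is the coefficient of \<open>t\<^sup>m\<close>, where \<open>m\<close> is
  the largest (\<open>c = 1\<close>) or the smallest (\<open>c = - 1\<close>) occurring exponent of \<open>t\<close>.
\<close>

definition extremal_limit :: "int \<Rightarrow> laurent3 \<Rightarrow> laurent2" where
  "extremal_limit c p =
     (let m = c * Max ((\<lambda>(i, j, k). c * k) ` Poly_Mapping.keys p)
      in \<Sum>(i, j, k)\<in>{(i, j, k)\<in>Poly_Mapping.keys p. k = m}.
           Poly_Mapping.single (i, j) (Poly_Mapping.lookup p (i, j, k)))"

definition is_extremal_y :: "(nat \<Rightarrow> int) \<Rightarrow> rat fps \<Rightarrow> bool" where
  "is_extremal_y \<beta> y \<longleftrightarrow>
     fps_nth y 0 = 1 \<and>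
     fps_X * fps_deriv y / y =
       fps_const (1 / 2) *
       formal_sum (\<lambda>r. fps_const (of_nat r ^ 2 * of_int (\<beta> r)) * fps_X ^ r / (1 - fps_X ^ r))"

text \<open>The value \<open>P(x, y(x))\<close> as a formal Laurent series in \<open>x\<close>.\<close>

definition eval_at :: "laurent2 \<Rightarrow> rat fps \<Rightarrow> rat fls" where
  "eval_at P y = (\<Sum>(i, j)\<in>Poly_Mapping.keys P.
     fls_const (Poly_Mapping.lookup P (i, j)) * fls_X powi i * fps_to_fls y powi j)"

definition extremal_A_polynomial ::
    "int \<Rightarrow> (nat \<Rightarrow> int \<Rightarrow> int \<Rightarrow> int) \<Rightarrow> int \<Rightarrow> laurent2 \<Rightarrow> bool" where
  "extremal_A_polynomial \<tau> N c P \<longleftrightarrow>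
     (\<exists>D. dual_A_polynomial \<tau> D \<and>
          irreducible P \<and>
          P dvd extremal_limit c (rescale_x c D) \<and>
          (\<exists>y. is_extremal_y (extremal_BPS N c) y \<and> eval_at P y = 0))"


section \<open>Arithmetic functions\<close>

definition mobius :: "nat \<Rightarrow> int" where
  "mobius n = (if squarefree n then (-1) ^ card (prime_factors n) else 0)"

text \<open>For an integer upper argument; it agrees with \<open>gchoose\<close>.\<close>

definition int_binomial :: "int \<Rightarrow> nat \<Rightarrow> int" where
  "int_binomial n k =
     (if n < 0 then (-1) ^ k * int (nat (- n + int k - 1) choose k) else int (nat n choose k))"

end

theory Submission
  imports Defs "HOL-Library.Product_Lexorder"
begin

text \<open>
  Write \<open>s = q\<^sup>1\<^sup>/\<^sup>2\<close>, \<open>t = a\<^sup>1\<^sup>/\<^sup>2\<close>, \<open>h\<^sub>n\<close> for the framed invariants and \<open>Z(x) = \<Sum> h\<^sub>n x\<^sup>n\<close>. Everything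
  rests on the first-order recursion for \<open>h\<^sub>n\<close> (\<open>framed_H_Suc\<close>), which is used in two ways.

  The recursion is an operator \<open>a\<^sub>1 L + a\<^sub>0\<close> of order one with coprime coefficients. An operator of order
  zero cannot annihilate the nonvanishing \<open>h\<^sub>n\<close>, and coprimality forces every minimal operator to be
  a multiple of this one by a unit, hence by a monomial (\<open>quantum_A_polynomial_iff\<close>). At \<open>s = 1\<close> the
  dual A-polynomial becomes explicit, and its two extremal limits are, up to monomials, the
  trinomials \<open>y\<^sup>2 - 1 - \<sigma> x y\<^sup>2\<^sup>m\<close> with \<open>(\<sigma>, m) = ((-1)\<^sup>\<tau>, \<tau> + 1)\<close> and \<open>(-(-1)\<^sup>\<tau>, \<tau>)\<close>. Their Newton
  triangles make them irreducible (\<open>irreducible_newton_triangle\<close>), so they are the only candidates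
  for the extremal A-polynomials.

  For the BPS invariants, compare \<open>Z\<close> at dilated arguments. In the logarithm of \<open>Z(s x) / Z(s\<^sup>-\<^sup>1 x)\<close> the
  simple poles at \<open>s = 1\<close> that the Ooguri--Vafa form allows cancel. The quotient therefore has a limit \<open>Y\<close>
  for \<open>s \<rightarrow> 1\<close>, and the \<open>n\<close>-th coefficient of \<open>x Y' / Y\<close> is the sum of \<open>r\<^sup>2 b\<^sub>r\<^sub>,\<^sub>i t\<^sup>i\<^sup>n\<^sup>/\<^sup>r\<close> over the
  divisors \<open>r\<close> of \<open>n\<close> and all \<open>i\<close>. In the same way \<open>Z(s\<^sup>2\<^sup>m\<^sup>-\<^sup>1 x) / Z(s\<^sup>-\<^sup>1 x)\<close> tends to \<open>Y\<^sup>m\<close> for every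
  integer \<open>m\<close>. The recursion, divided by \<open>Z(s\<^sup>-\<^sup>1 x)\<close>, thus becomes the algebraic equation
  \<open>Y - 1 = (-1)\<^sup>\<tau> x (t Y\<^sup>\<tau>\<^sup>+\<^sup>1 - t\<^sup>-\<^sup>1 Y\<^sup>\<tau>)\<close>, and Lagrange inversion gives \<open>x Y' / Y\<close> in closed form
  (\<open>BPS_log_deriv_lagrange\<close>, \<open>BPS_log_deriv_explicit\<close>). The coefficients of \<open>x\<^sup>n t\<^sup>n\<close> and \<open>x\<^sup>n t\<^sup>-\<^sup>n\<close>
  contain exactly the extremal invariants, one binomial coefficient each, and Moebius inversion
  proves the formulas of the second part.

  These closed forms are also the ones that Lagrange inversion gives for the two equations
  \<open>Y - 1 = \<sigma> x Y\<^sup>m\<close>. Hence the series \<open>y\<close> determined by the extremal BPS invariants satisfies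
  \<open>y\<^sup>2 = Y\<close> and is a zero of the corresponding trinomial (\<open>exists_extremal_y\<close>), which completes the
  first part.
\<close>

unbundle fps_syntax
notation fls_nth (infixl \<open>$$\<close> 75)

section \<open>Lagrange inversion and logarithmic derivatives\<close>

lemma fps_to_fls_sum: "fps_to_fls (sum f A) = (\<Sum>x\<in>A. fps_to_fls (f x))"
  by (induction A rule: infinite_finite_induct) simp_all

lemma fls_nth_sum: "(sum f A) $$ n = (\<Sum>x\<in>A. f x $$ n)"
  by (induction A rule: infinite_finite_induct) simp_all

text \<open>The form \<open>v' v\<^sup>-\<^sup>m\<^sup>-\<^sup>1 dx\<close> is exact for \<open>m > 0\<close>, and for \<open>m = 0\<close> its residue is the order of vanishing.\<close>

lemma residue_deriv_mult_inverse_power: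
  fixes v :: "'a::field_char_0 fls"
  assumes "v \<noteq> 0"
  shows "fls_residue (fls_deriv v * inverse v ^ Suc m) = (if m = 0 then of_int (fls_subdegree v) else 0)"
proof (cases m)
  case 0
  then show ?thesis
    using fls_residue_deriv_times_inverse_eq_subdegree(1)[of v] by simp
next
  case (Suc k)
  have "fls_deriv (inverse v ^ m) = - of_nat m * (fls_deriv v * inverse v ^ Suc m)"
    unfolding fls_deriv_power Suc
    by (simp add: fls_inverse_deriv power2_eq_square algebra_simps)
  then have "- of_nat m * fls_residue (fls_deriv v * inverse v ^ Suc m) = 0"
    using fls_residue_deriv[of "inverse v ^ m"]
      fls_residue_of_int_times(1)[of "- int m" "fls_deriv v * inverse v ^ Suc m"]
    by (simp del: fls_residue_def power_Suc)
  with Suc show ?thesis by (simp del: fls_residue_def of_nat_Suc)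
qed

text \<open>
  Lagrange inversion, by a change of variables in a residue. The series \<open>v = x / \<phi>\<close> is the
  compositional inverse of \<open>W\<close>, so the \<open>n\<close>-th coefficient of \<open>G = (H \<circ> W)'\<close> is the residue of
  \<open>(G \<circ> v) v\<^sup>-\<^sup>n\<^sup>-\<^sup>1 dv\<close>, which equals \<open>H' v\<^sup>-\<^sup>n\<^sup>-\<^sup>1 dx = H' \<phi>\<^sup>n\<^sup>+\<^sup>1 x\<^sup>-\<^sup>n\<^sup>-\<^sup>1 dx\<close>.
\<close>

lemma lagrange_inversion:
  fixes \<phi> H W :: "'a::field_char_0 fps"
  assumes \<phi>: "\<phi> $ 0 \<noteq> 0" and W: "W = fps_X * (\<phi> oo W)"
  shows "fps_deriv (H oo W) $ n = (fps_deriv H * \<phi> ^ Suc n) $ n"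
proof -
  define v where "v = fps_X * inverse \<phi>"
  have W0: "W $ 0 = 0" by (subst W) simp
  have v0: "v $ 0 = 0" and v1: "v $ 1 \<noteq> 0" using \<phi> by (simp_all add: v_def)
  have vW: "v oo W = fps_X"
  proof -
    have "v oo W = W * inverse (\<phi> oo W)"
      using \<phi> W0 by (simp add: v_def fps_compose_mult_distrib fps_inverse_compose)
    also have "\<dots> = fps_X * ((\<phi> oo W) * inverse (\<phi> oo W))"
      by (subst W) (simp add: mult.assoc)
    finally show ?thesis using \<phi> by (simp add: inverse_mult_eq_1' )
  qed
  have Wv: "W oo v = fps_X"
  proof -
    have "W = fps_inv v oo (v oo W)"
      using fps_inv[OF v0 v1] W0 v0 by (simp add: fps_compose_assoc)
    then have "W = fps_inv v" by (simp add: vW)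
    then show ?thesis using fps_inv[OF v0 v1] by simp
  qed
  define G where "G = fps_deriv (H oo W)"
  \<comment> \<open>Only the terms of \<open>G\<close> of degree at most \<open>n\<close> can contribute to the residue.\<close>
  define R where "R = fps_shift (Suc n) G"
  have split: "G = (\<Sum>k\<le>n. fps_const (G $ k) * fps_X ^ k) + fps_X ^ Suc n * R"
  proof (rule fps_ext)
    fix i
    have "(\<Sum>k\<le>n. fps_const (G $ k) * fps_X ^ k) $ i = (\<Sum>k\<le>n. if i = k then G $ k else 0)"
      by (subst fps_sum_nth, rule sum.cong) (auto)
    then show "G $ i = ((\<Sum>k\<le>n. fps_const (G $ k) * fps_X ^ k) + fps_X ^ Suc n * R) $ i"
      by (auto simp: R_def fps_X_power_mult_nth simp del: power_Suc)
  qed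
  let ?f = fps_to_fls
  let ?v = "?f v"
  have vnz: "?v \<noteq> 0" using v1 by auto
  have sd: "fls_subdegree ?v = 1"
    using v0 v1 subdegreeI[of v 1] by (simp add: fls_subdegree_fls_to_fps)
  have inv: "inverse ?v = ?f \<phi> * fls_X_inv"
  proof -
    have "?v * (?f \<phi> * fls_X_inv) = (?f (inverse \<phi> * \<phi>)) * (fls_X * inverse fls_X)"
      by (simp add: v_def fls_times_fps_to_fls fls_inverse_X mult_ac del: right_inverse)
    also have "\<dots> = 1" using \<phi> by (simp add: inverse_mult_eq_1)
    finally show ?thesis by (metis inverse_unique)
  qed
  have "fps_deriv H = fps_deriv ((H oo W) oo v)"
    using Wv v0 W0 by (simp flip: fps_compose_assoc)
  also have "\<dots> = (G oo v) * fps_deriv v"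
    using v0 by (simp add: fps_compose_deriv G_def)
  also have "G oo v = (\<Sum>k\<le>n. fps_const (G $ k) * v ^ k) + v ^ Suc n * (R oo v)"
    using v0 by (subst split)
      (simp add: fps_compose_add_distrib fps_compose_sum_distrib fps_compose_mult_distrib
         fps_compose_power[symmetric] del: power_Suc)
  finally have H': "?f (fps_deriv H) =
      (\<Sum>k\<le>n. fls_const (G $ k) * (fls_deriv ?v * ?v ^ k)) + ?v ^ Suc n * ?f ((R oo v) * fps_deriv v)"
    by (simp add: fls_times_fps_to_fls fls_deriv_fps_to_fls fps_to_fls_power fps_to_fls_sum
        fps_const_to_fls sum_distrib_left algebra_simps del: power_Suc)
  have pw: "?v ^ k * inverse ?v ^ Suc n = inverse ?v ^ Suc (n - k)" if "k \<le> n" for k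
  proof -
    have "inverse ?v ^ Suc n = inverse ?v ^ k * inverse ?v ^ Suc (n - k)"
      using that by (simp flip: power_add)
    then show ?thesis using vnz by (simp add: power_mult_distrib[symmetric] flip: mult.assoc)
  qed
  have cancel: "?v ^ Suc n * inverse ?v ^ Suc n = 1"
    using vnz by (simp add: power_mult_distrib[symmetric] del: power_Suc)
  have "?f (fps_deriv H) * inverse ?v ^ Suc n =
      (\<Sum>k\<le>n. fls_const (G $ k) * (fls_deriv ?v * (?v ^ k * inverse ?v ^ Suc n)))
      + (?v ^ Suc n * inverse ?v ^ Suc n) * ?f ((R oo v) * fps_deriv v)"
    unfolding H' by (simp only: distrib_left distrib_right sum_distrib_left sum_distrib_right mult_ac)
  also have "\<dots> = (\<Sum>k\<le>n. fls_const (G $ k) * (fls_deriv ?v * inverse ?v ^ Suc (n - k)))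
      + ?f ((R oo v) * fps_deriv v)"
    by (simp only: cancel mult_1) (simp add: pw del: power_Suc)
  finally have "fls_residue (?f (fps_deriv H) * inverse ?v ^ Suc n) =
     (\<Sum>k\<le>n. G $ k * fls_residue (fls_deriv ?v * inverse ?v ^ Suc (n - k)))"
    by (simp add: fls_nth_sum del: power_Suc)
  also have "\<dots> = (\<Sum>k\<le>n. if k = n then G $ k else 0)"
    using residue_deriv_mult_inverse_power[OF vnz] sd by (intro sum.cong) auto
  also have "\<dots> = G $ n" by simp
  finally have "G $ n = fls_residue (?f (fps_deriv H * \<phi> ^ Suc n) * fls_X_inv ^ Suc n)"
    by (simp add: inv power_mult_distrib fls_times_fps_to_fls fps_to_fls_power mult_ac del: power_Suc)
  also have "\<dots> = (fps_deriv H * \<phi> ^ Suc n) $ n"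
    by (simp add: fls_X_inv_power_conv_shift_1 fls_times_both_shifted_simp fls_shifted_times_simps del: power_Suc)
  finally show ?thesis by (simp add: G_def)
qed

lemma exists_lagrange_series:
  fixes \<phi> :: "'a::field_char_0 fps"
  assumes \<phi>: "\<phi> $ 0 \<noteq> 0"
  shows "\<exists>W. W = fps_X * (\<phi> oo W)"
proof -
  \<comment> \<open>The equation says that \<open>W\<close> is the compositional inverse of \<open>x / \<phi>\<close>.\<close>
  define v where "v = fps_X * inverse \<phi>"
  define W where "W = fps_inv v"
  have v0: "v $ 0 = 0" and v1: "v $ 1 \<noteq> 0" using \<phi> by (simp_all add: v_def)
  have W0: "W $ 0 = 0" by (simp add: W_def fps_inv_def)
  have "fps_X = v oo W" using fps_inv_right[OF v0 v1] by (simp add: W_def)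
  also have "\<dots> = W * inverse (\<phi> oo W)"
    using \<phi> W0 by (simp add: v_def fps_compose_mult_distrib fps_inverse_compose)
  finally have "fps_X * (\<phi> oo W) = W * (inverse (\<phi> oo W) * (\<phi> oo W))" by (simp add: mult_ac)
  then have "W = fps_X * (\<phi> oo W)" using \<phi> by (simp add: inverse_mult_eq_1)
  then show ?thesis ..
qed

lemma fps_X_mult_deriv_nth: "(fps_X * fps_deriv f) $ n = of_nat n * (f $ n)"
  for f :: "'a::comm_ring_1 fps"
  by (cases n) auto

text \<open>
  The logarithmic derivative \<open>E = x f' / f\<close> and the constant term determine \<open>f\<close>, because
  \<open>n f\<^sub>n = \<Sum>\<^sub>i E\<^sub>i f\<^sub>n\<^sub>-\<^sub>i\<close>. In this section and later, a logarithmic derivative is always given in the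
  form \<open>x f' = E f\<close>, which makes sense before \<open>f\<close> is known to be invertible.
\<close>

lemma log_deriv_unique:
  fixes f g E :: "'a::field_char_0 fps"
  assumes "fps_X * fps_deriv f = E * f" "fps_X * fps_deriv g = E * g" "E $ 0 = 0" "f $ 0 = g $ 0"
  shows "f = g"
proof -
  have "f $ n = g $ n" for n
  proof (induction n rule: less_induct)
    case (less n)
    show ?case
    proof (cases "n = 0")
      case False
      have rec: "of_nat n * (h $ n) = (\<Sum>i=1..n. E $ i * h $ (n - i))"
        if "fps_X * fps_deriv h = E * h" for h
      proof -
        have "of_nat n * (h $ n) = (E * h) $ n" by (simp flip: that fps_X_mult_deriv_nth)
        also have "\<dots> = (\<Sum>i=1..n. E $ i * h $ (n - i))"
          unfolding fps_mult_nth using assms(3) by (simp add: sum.atLeast_Suc_atMost)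
        finally show ?thesis .
      qed
      have "of_nat n * (f $ n) = of_nat n * (g $ n)"
        unfolding rec[OF assms(1)] rec[OF assms(2)] using less by (intro sum.cong) auto
      with False show ?thesis by simp
    qed (use assms in auto)
  qed
  then show ?thesis by (simp add: fps_ext)
qed

lemma log_deriv_divide:
  fixes A B :: "'a::field fps"
  assumes A: "fps_X * fps_deriv A = E * A" and B: "fps_X * fps_deriv B = G * B" and B0: "B $ 0 \<noteq> 0"
  shows "fps_X * fps_deriv (A * inverse B) = (E - G) * (A * inverse B)"
proof -
  have "fps_X * fps_deriv (A * inverse B) = (fps_X * fps_deriv A) * inverse B - A * (fps_X * fps_deriv B) * (inverse B)\<^sup>2"
    using B0 by (simp add: fps_inverse_deriv algebra_simps)
  also have "\<dots> = (E - G * (B * inverse B)) * (A * inverse B)"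
    unfolding A B by (simp add: power2_eq_square algebra_simps)
  finally show ?thesis using B0 by (simp add: inverse_mult_eq_1')
qed

lemma log_deriv_exp:
  fixes F :: "'a::field_char_0 fps"
  assumes "F $ 0 = 0"
  shows "fps_X * fps_deriv (fps_exp 1 oo F) = (fps_X * fps_deriv F) * (fps_exp 1 oo F)"
  by (simp add: fps_compose_deriv[OF assms] mult_ac)

definition dilate :: "'a::comm_ring_1 \<Rightarrow> 'a fps \<Rightarrow> 'a fps" where
  "dilate c f = Abs_fps (\<lambda>n. c ^ n * f $ n)"

lemma dilate_nth [simp]: "dilate c f $ n = c ^ n * f $ n"
  by (simp add: dilate_def)

lemma dilate_mult: "dilate c (f * g) = dilate c f * dilate c g"
proof (rule fps_ext)
  fix n
  have "c ^ n * (f $ i * g $ (n - i)) = c ^ i * f $ i * (c ^ (n - i) * g $ (n - i))" if "i \<le> n" for i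
    using that by (simp add: mult_ac flip: power_add)
  then show "dilate c (f * g) $ n = (dilate c f * dilate c g) $ n"
    by (simp add: fps_mult_nth sum_distrib_left)
qed

lemma log_deriv_dilate:
  assumes "fps_X * fps_deriv f = E * f"
  shows "fps_X * fps_deriv (dilate c f) = dilate c E * dilate c f"
proof -
  have "fps_X * fps_deriv (dilate c f) = dilate c (fps_X * fps_deriv f)"
    by (rule fps_ext) (simp only: fps_X_mult_deriv_nth dilate_nth mult_ac)
  then show ?thesis by (simp add: assms dilate_mult)
qed

lemma log_deriv_binomial_compose:
  fixes W :: "'a::field_char_0 fps"
  assumes W0: "W $ 0 = 0"
  shows "fps_X * fps_deriv (fps_binomial c oo W) =
         fps_const c * (fps_X * fps_deriv W * inverse (1 + W)) * (fps_binomial c oo W)"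
proof -
  have "fps_deriv (fps_binomial c oo W) = (fps_const c * fps_binomial c * inverse (1 + fps_X) oo W) * fps_deriv W"
    by (simp add: fps_compose_deriv[OF W0] fps_binomial_deriv fps_divide_unit)
  also have "\<dots> = fps_const c * (fps_binomial c oo W) * inverse (1 + W) * fps_deriv W"
    using W0 by (simp add: fps_compose_mult_distrib fps_inverse_compose fps_compose_add_distrib)
  finally show ?thesis by (simp add: mult_ac)
qed

text \<open>
  The form in which Lagrange inversion is used: \<open>1 + W\<close> has the logarithmic derivative
  \<open>x W' / (1 + W)\<close>, and \<open>H = log (1 + x)\<close> is an antiderivative of the binomial series of
  exponent \<open>-1\<close>.
\<close>

lemma log_deriv_lagrange:
  fixes \<phi> W :: "'a::field_char_0 fps"
  assumes \<phi>: "\<phi> $ 0 \<noteq> 0" and W: "W = fps_X * (\<phi> oo W)"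
  shows "(fps_X * fps_deriv W * inverse (1 + W)) $ Suc n = (fps_binomial (-1) * \<phi> ^ Suc n) $ n"
proof -
  have W0: "W $ 0 = 0" by (subst W) simp
  obtain H :: "'a fps" where H: "fps_deriv H = fps_binomial (-1)"
    using fps_deriv_fps_integral[of "fps_binomial (-1)" 0] by blast
  have "fps_deriv (H oo W) = inverse (1 + W) * fps_deriv W"
    using W0 by (simp add: fps_compose_deriv H fps_binomial_minus_one fps_inverse_compose fps_compose_add_distrib)
  then have "fps_X * fps_deriv W * inverse (1 + W) = fps_X * fps_deriv (H oo W)"
    by (simp add: mult_ac)
  then have "(fps_X * fps_deriv W * inverse (1 + W)) $ Suc n = fps_deriv (H oo W) $ n"
    by (simp only:) simp
  then show ?thesis by (simp only: lagrange_inversion[OF \<phi> W] H)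
qed

text \<open>
  The series \<open>(1 + W)\<^sup>1\<^sup>/\<^sup>2\<close>, whose powers with integral exponents, negative ones included, are read
  off from binomial series.
\<close>

lemma fps_binomial_half_power_int:
  fixes W :: "'a::field_char_0 fps"
  assumes W0: "W $ 0 = 0"
  shows "fps_to_fls (fps_binomial (1 / 2) oo W) powi n = fps_to_fls (fps_binomial (of_int n / 2) oo W)"
proof -
  have pos: "fps_to_fls (fps_binomial (1 / 2) oo W) ^ k = fps_to_fls (fps_binomial (of_nat k / 2) oo W)" for k
    using W0 by (simp add: fps_to_fls_power[symmetric] fps_compose_power[OF W0] fps_binomial_power)
  show ?thesis
  proof (cases "n \<ge> 0")
    case True
    then show ?thesis using pos[of "nat n"] by (simp add: power_int_def)
  next
    case False
    define k where "k = nat (- n)"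
    have n: "n = - int k" using False by (simp add: k_def)
    have "fps_to_fls (fps_binomial (of_nat k / 2) oo W) * fps_to_fls (fps_binomial (of_int n / 2) oo W)
        = fps_to_fls (fps_binomial (of_nat k / 2 + of_int n / 2) oo W)"
      using W0 by (simp add: fps_binomial_add_mult fps_compose_mult_distrib fls_times_fps_to_fls)
    also have "\<dots> = 1" by (simp add: n)
    finally show ?thesis
      using inverse_unique unfolding n power_int_minus power_int_of_nat pos by blast
  qed
qed

lemma lambert_term_nth:
  fixes c :: "'a::field"
  assumes r: "r \<ge> 1"
  shows "(fps_const c * fps_X ^ r / (1 - fps_X ^ r)) $ n = (if n \<ge> 1 \<and> r dvd n then c else 0)"
proof -
  define S where "S = Abs_fps (\<lambda>n. if n \<ge> 1 \<and> r dvd n then c else 0)"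
  have "fps_const c * fps_X ^ r = S * (1 - fps_X ^ r)"
  proof (rule fps_ext)
    fix n
    have *: "r dvd n - r \<longleftrightarrow> r dvd n" if "r \<le> n"
      using that by (metis dvd_diff_nat dvd_refl le_add_diff_inverse2 dvd_add_left_iff)
    have "(S * (1 - fps_X ^ r)) $ n = S $ n - (if n < r then 0 else S $ (n - r))"
      by (simp add: right_diff_distrib fps_X_power_mult_right_nth)
    then show "(fps_const c * fps_X ^ r) $ n = (S * (1 - fps_X ^ r)) $ n"
      using r * by (auto simp: S_def fps_X_power_nth dest: dvd_imp_le)
  qed
  moreover have "(1 - fps_X ^ r :: 'a fps) \<noteq> 0"
  proof
    assume "(1 - fps_X ^ r :: 'a fps) = 0"
    then have "(1 - fps_X ^ r :: 'a fps) $ 0 = 0" by (simp only: fps_zero_nth)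
    with r show False by (simp add: fps_X_power_nth)
  qed
  ultimately have "fps_const c * fps_X ^ r / (1 - fps_X ^ r) = S" by simp
  then show ?thesis by (simp add: S_def)
qed

section \<open>Sums over divisors and Moebius inversion\<close>

lemma sum_divisor_pairs:
  fixes h :: "nat \<Rightarrow> nat \<Rightarrow> 'a::comm_monoid_add"
  assumes "n \<ge> 1"
  shows "(\<Sum>d=1..n. \<Sum>r=1..n. if r * d = n then h d r else 0) = (\<Sum>r | r dvd n. h (n div r) r)"
proof -
  have "(\<Sum>d=1..n. \<Sum>r=1..n. if r * d = n then h d r else 0) = (\<Sum>r=1..n. \<Sum>d=1..n. if r * d = n then h d r else 0)"
    by (rule sum.swap)
  also have "\<dots> = (\<Sum>r=1..n. if r dvd n then h (n div r) r else 0)"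
  proof (intro sum.cong refl)
    fix r assume r: "r \<in> {1..n}"
    have "(\<Sum>d=1..n. if r * d = n then h d r else 0)
        = (\<Sum>d=1..n. if d = n div r then (if r dvd n then h (n div r) r else 0) else 0)"
      using r by (intro sum.cong refl) auto
    also have "\<dots> = (if r dvd n then h (n div r) r else 0)"
      using r assms by (simp add: Suc_le_eq div_greater_zero_iff)
    finally show "(\<Sum>d=1..n. if r * d = n then h d r else 0) = (if r dvd n then h (n div r) r else 0)" .
  qed
  also have "\<dots> = (\<Sum>r | r dvd n. h (n div r) r)"
    using assms by (subst sum.inter_filter[symmetric]) (auto intro!: sum.cong dest: dvd_imp_le simp: dvd_pos_nat Suc_le_eq)
  finally show ?thesis .
qed

text \<open>
  The squarefree divisors of \<open>n\<close> are the products of the sets of prime factors of \<open>n\<close>, so the sum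
  is \<open>(1 - 1)\<^sup>k\<close> with \<open>k > 0\<close> the number of prime factors.
\<close>

lemma sum_mobius_eq_0:
  assumes "n > (1::nat)"
  shows "(\<Sum>d | d dvd n. mobius d) = 0"
proof -
  let ?P = "prime_factors n"
  have n0: "n \<noteq> 0" using assms by simp
  obtain p where p: "prime p" "p dvd n" using assms prime_factor_nat[of n] by auto
  have "(\<Sum>d | d dvd n. mobius d) = (\<Sum>d | d dvd n \<and> squarefree d. (-1) ^ card (prime_factors d))"
    using n0 by (intro sum.mono_neutral_cong_right) (auto simp: mobius_def)
  also have "\<dots> = (\<Sum>A\<in>Pow ?P. (-1) ^ card A)"
  proof (rule sum.reindex_bij_witness[where i = "\<lambda>A. \<Prod>A" and j = prime_factors])
    fix d assume d: "d \<in> {d. d dvd n \<and> squarefree d}"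
    then have "d \<noteq> 0" using n0 by auto
    have "d = (\<Prod>p\<in>prime_factors d. p ^ multiplicity p d)"
      using prime_factorization_nat[of d] \<open>d \<noteq> 0\<close> by simp
    also have "\<dots> = \<Prod>(prime_factors d)"
      using d \<open>d \<noteq> 0\<close> by (intro prod.cong) (auto simp: squarefree_factorial_semiring')
    finally show "\<Prod>(prime_factors d) = d" ..
    show "prime_factors d \<in> Pow ?P"
      using d n0 dvd_prime_factors[of n d] by auto
  next
    fix A assume A: "A \<in> Pow ?P"
    then have fin: "finite A" and pr: "\<forall>p\<in>A. prime p"
      by (auto intro: finite_subset)
    have mult: "multiplicity q (\<Prod>A) = (if q \<in> A then 1 else 0)" if "prime q" for q
    proof -
      have "multiplicity q (\<Prod>A) = sum (multiplicity q) A"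
        using pr that by (intro prime_elem_multiplicity_prod_distrib) (auto simp: fin)
      also have "\<dots> = (\<Sum>p\<in>A. if p = q then 1 else 0)"
        using pr that by (intro sum.cong) (auto simp: prime_multiplicity_other)
      finally show ?thesis using fin by simp
    qed
    have nz: "\<Prod>A \<noteq> 0" using fin pr by auto
    show pf: "prime_factors (\<Prod>A) = A"
      using mult pr nz by (auto simp: prime_factors_multiplicity split: if_splits)
    have sqf: "squarefree (\<Prod>A)"
      using nz mult by (auto simp: squarefree_factorial_semiring'' )
    have "\<Prod>A dvd n"
      using nz n0 A mult by (intro multiplicity_le_imp_dvd)
        (auto simp: prime_factors_multiplicity Suc_le_eq)
    then show "\<Prod>A \<in> {d. d dvd n \<and> squarefree d}" using sqf by auto
  qed auto
  also have "\<dots> = (\<Prod>p\<in>?P. 1 - 1)"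
    by (subst prod_diff_conv_sum) auto
  also have "\<dots> = 0"
  proof -
    have "p \<in> ?P" using p n0 by (simp add: prime_factors_dvd)
    then show ?thesis by (auto simp: card_gt_0_iff simp del: prime_factors_dvd)
  qed
  finally show ?thesis .
qed

lemma mobius_inversion:
  fixes f g :: "nat \<Rightarrow> 'a::comm_ring_1"
  assumes g: "\<And>m. m \<ge> 1 \<Longrightarrow> (\<Sum>d | d dvd m. f d) = g m" and "n \<ge> 1"
  shows "f n = (\<Sum>d | d dvd n. of_int (mobius (n div d)) * g d)"
proof -
  have n0: "n > 0" using assms by simp
  have "(\<Sum>d | d dvd n. of_int (mobius (n div d)) * g d)
      = (\<Sum>d | d dvd n. \<Sum>e | e dvd d. of_int (mobius (n div d)) * f e)"
    using n0 by (intro sum.cong refl) (auto simp: sum_distrib_left Suc_le_eq dvd_pos_nat simp flip: g)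
  also have "\<dots> = (\<Sum>e | e dvd n. \<Sum>k | k dvd n div e. of_int (mobius k) * f e)"
  \<comment> \<open>The chains \<open>e dvd d dvd n\<close> are enumerated by \<open>e\<close> and \<open>k = n div d\<close>.\<close>
  proof -
    have fin: "finite {d. d dvd m}" if "m > 0" for m :: nat
      using that by (rule finite_divisors_nat)
    have pos: "m > 0" if "m dvd n" for m
      using that n0 by (rule dvd_pos_nat[rotated])
    have "(\<Sum>d | d dvd n. \<Sum>e | e dvd d. of_int (mobius (n div d)) * f e)
        = (\<Sum>(d, e)\<in>Sigma {d. d dvd n} (\<lambda>d. {e. e dvd d}). of_int (mobius (n div d)) * f e)"
      using n0 pos by (intro sum.Sigma) (auto intro: fin)
    also have "\<dots> = (\<Sum>(e, k)\<in>Sigma {e. e dvd n} (\<lambda>e. {k. k dvd n div e}). of_int (mobius k) * f e)"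
      by (rule sum.reindex_bij_witness[where i = "\<lambda>(e, k). (n div k, e)" and j = "\<lambda>(d, e). (e, n div d)"])
        (use n0 in \<open>auto elim!: dvdE\<close>)
    also have "\<dots> = (\<Sum>e | e dvd n. \<Sum>k | k dvd n div e. of_int (mobius k) * f e)"
      using n0 by (intro sum.Sigma[symmetric]) (auto intro!: fin simp: div_greater_zero_iff dest: dvd_imp_le)
    finally show ?thesis .
  qed
  also have "\<dots> = (\<Sum>e | e dvd n. if e = n then f e else 0)"
  proof (intro sum.cong refl)
    fix e assume "e \<in> {e. e dvd n}"
    then have e: "e dvd n" by simp
    show "(\<Sum>k | k dvd n div e. of_int (mobius k) * f e) = (if e = n then f e else 0)"
    proof (cases "e = n")
      case True
      then show ?thesis using n0 by (simp add: mobius_def)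
    next
      case False
      then have "n div e > 1" using e n0 by (metis One_nat_def Suc_lessI dvd_div_eq_0_iff dvd_div_mult_self mult_1 not_gr0)
      then show ?thesis using False sum_mobius_eq_0[of "n div e"]
        by (simp flip: sum_distrib_right of_int_sum)
    qed
  qed
  also have "\<dots> = f n" using n0 by (simp add: sum.delta')
  finally show ?thesis ..
qed

lemma mobius_divide_square:
  fixes \<beta> :: "nat \<Rightarrow> int" and g :: "nat \<Rightarrow> rat"
  assumes "\<And>n. n \<ge> 1 \<Longrightarrow> (\<Sum>r | r dvd n. of_nat r ^ 2 * of_int (\<beta> r)) = g n" and "r \<ge> 1"
  shows "of_int (\<beta> r) = 1 / of_nat r ^ 2 * (\<Sum>d | d dvd r. of_int (mobius (r div d)) * g d)"
  using mobius_inversion[of "\<lambda>r. of_nat r ^ 2 * of_int (\<beta> r)" g r] assms by (simp add: field_simps)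

section \<open>Group rings of ordered groups\<close>

text \<open>
  With the lexicographic order, \<open>\<int>\<^sup>2\<close> and \<open>\<int>\<^sup>3\<close> are ordered groups, which makes their group rings
  integral domains.
\<close>

instance prod :: (linordered_ab_group_add, linordered_ab_group_add) linordered_ab_group_add
  by standard (auto simp: less_eq_prod_def plus_prod_def)

lemma poly_mapping_sum_single:
  fixes p :: "'e \<Rightarrow>\<^sub>0 'b::comm_monoid_add"
  shows
  "(\<Sum>e\<in>Poly_Mapping.keys p. Poly_Mapping.single e (Poly_Mapping.lookup p e)) = p"
proof (rule poly_mapping_eqI)
  fix k
  have "Poly_Mapping.lookup (\<Sum>e\<in>Poly_Mapping.keys p. Poly_Mapping.single e (Poly_Mapping.lookup p e)) k
      = (\<Sum>e\<in>Poly_Mapping.keys p. if e = k then Poly_Mapping.lookup p e else 0)"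
    by (simp add: lookup_sum lookup_single when_def)
  then show "Poly_Mapping.lookup (\<Sum>e\<in>Poly_Mapping.keys p. Poly_Mapping.single e (Poly_Mapping.lookup p e)) k
      = Poly_Mapping.lookup p k"
    by (simp add: in_keys_iff)
qed

lemma poly_mapping_single_add_induct [case_names single add]:
  fixes p :: "'e \<Rightarrow>\<^sub>0 'b::comm_monoid_add"
  assumes single: "\<And>e c. P (Poly_Mapping.single e c)" and add: "\<And>p q. P p \<Longrightarrow> P q \<Longrightarrow> P (p + q)"
  shows "P p"
proof -
  have "P (\<Sum>e\<in>A. Poly_Mapping.single e (Poly_Mapping.lookup p e))" if "finite A" for A
    using that
  proof (induction A)
    case empty
    show ?case using single[of undefined 0] by simp
  qed (auto intro: single add)
  from this[of "Poly_Mapping.keys p"] show ?thesis by (simp add: poly_mapping_sum_single)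
qed

definition lin_ext :: "('e \<Rightarrow> 'b \<Rightarrow> 'c) \<Rightarrow> ('e \<Rightarrow>\<^sub>0 'b::zero) \<Rightarrow> 'c::comm_monoid_add" where
  "lin_ext F p = (\<Sum>e\<in>Poly_Mapping.keys p. F e (Poly_Mapping.lookup p e))"

lemma lin_ext_single: "F e 0 = 0 \<Longrightarrow> lin_ext F (Poly_Mapping.single e c) = F e c"
  by (simp add: lin_ext_def)

lemma lin_ext_add:
  assumes "\<And>e. F e 0 = 0" "\<And>e a b. F e (a + b) = F e a + F e b"
  shows "lin_ext F (p + q) = lin_ext F p + lin_ext F q"
  unfolding lin_ext_def using assms by (intro setsum_keys_plus_distrib)

text \<open>
  Substitutions into Laurent polynomials are linear extensions of maps on monomials, and they are
  ring homomorphisms as soon as they are multiplicative on monomials.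
\<close>

lemma lin_ext_mult:
  fixes F :: "'e::monoid_add \<Rightarrow> 'b::semiring_0 \<Rightarrow> 'c::semiring_0"
  assumes "\<And>e. F e 0 = 0" "\<And>e a b. F e (a + b) = F e a + F e b"
    and "\<And>e e' a b. F (e + e') (a * b) = F e a * F e' b"
  shows "lin_ext F (p * q) = lin_ext F p * lin_ext F q"
proof (induction p rule: poly_mapping_single_add_induct)
  case (single e c)
  show ?case
    by (induction q rule: poly_mapping_single_add_induct)
      (simp_all add: mult_single lin_ext_single lin_ext_add assms distrib_left)
qed (simp add: distrib_right lin_ext_add assms)

lemma monomial_subst_lin_ext: "monomial_subst \<phi> = lin_ext (\<lambda>e. Poly_Mapping.single (\<phi> e))"
  by (simp add: fun_eq_iff monomial_subst_def lin_ext_def)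

lemma monomial_subst_single [simp]:
  "monomial_subst \<phi> (Poly_Mapping.single e c) = Poly_Mapping.single (\<phi> e) c"
  by (simp add: monomial_subst_lin_ext lin_ext_single)

lemma monomial_subst_0 [simp]: "monomial_subst \<phi> 0 = 0"
  by (simp add: monomial_subst_def)

lemma monomial_subst_add: "monomial_subst \<phi> (p + q) = monomial_subst \<phi> p + monomial_subst \<phi> q"
  by (simp add: monomial_subst_lin_ext lin_ext_add single_add)

lemma monomial_subst_minus: "monomial_subst \<phi> (- p) = - monomial_subst \<phi> p"
  using monomial_subst_add[of \<phi> p "- p"] by (simp add: eq_neg_iff_add_eq_0 add.commute)

lemma monomial_subst_diff: "monomial_subst \<phi> (p - q) = monomial_subst \<phi> p - monomial_subst \<phi> q"
  using monomial_subst_add[of \<phi> p "- q"] by (simp add: monomial_subst_minus)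

lemma monomial_subst_mult:
  assumes "\<And>e e'. \<phi> (e + e') = \<phi> e + \<phi> e'"
  shows "monomial_subst \<phi> (p * q) = monomial_subst \<phi> p * monomial_subst \<phi> q"
  unfolding monomial_subst_lin_ext
  by (rule lin_ext_mult) (simp_all add: single_add mult_single assms)

lemma lookup_monomial_subst_inj:
  assumes "inj_on \<phi> (Poly_Mapping.keys p)" "e \<in> Poly_Mapping.keys p"
  shows "Poly_Mapping.lookup (monomial_subst \<phi> p) (\<phi> e) = Poly_Mapping.lookup p e"
proof -
  have "Poly_Mapping.lookup (monomial_subst \<phi> p) (\<phi> e)
      = (\<Sum>e'\<in>Poly_Mapping.keys p. if e' = e then Poly_Mapping.lookup p e else 0)"
    unfolding monomial_subst_def lookup_sum
    using assms by (intro sum.cong refl) (auto simp: lookup_single when_def dest: inj_onD)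
  then show ?thesis using assms by simp
qed

text \<open>
  The leading exponent in the ordering pulled back along \<open>w\<close>. Taking several \<open>w\<close>, for
  instance the negation, gives access to several corners of the Newton polytope.
\<close>

definition weighted_degree :: "('e \<Rightarrow> 'o) \<Rightarrow> ('e \<Rightarrow>\<^sub>0 'b::zero) \<Rightarrow> 'o::linorder" where
  "weighted_degree w p = Max (w ` Poly_Mapping.keys p)"

lemma weighted_degree_attained: "p \<noteq> 0 \<Longrightarrow> \<exists>e\<in>Poly_Mapping.keys p. w e = weighted_degree w p"
  unfolding weighted_degree_def using Max_in[of "w ` Poly_Mapping.keys p"] by fastforce

lemma weighted_degree_ge: "e \<in> Poly_Mapping.keys p \<Longrightarrow> w e \<le> weighted_degree w p"
  by (simp add: weighted_degree_def)

text \<open>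
  The product of the leading terms cannot cancel, since by injectivity of \<open>w\<close> every other product of
  terms has strictly smaller weight.
\<close>

lemma weighted_degree_mult:
  fixes w :: "'e::cancel_comm_monoid_add \<Rightarrow> 'o::linordered_ab_group_add" and p q :: "'e \<Rightarrow>\<^sub>0 'b::idom"
  assumes w: "\<And>e e'. w (e + e') = w e + w e'" and inj: "inj w" and nz: "p \<noteq> 0" "q \<noteq> 0"
  shows "weighted_degree w (p * q) = weighted_degree w p + weighted_degree w q"
proof -
  obtain e where e: "e \<in> Poly_Mapping.keys p" "w e = weighted_degree w p" using weighted_degree_attained[OF nz(1)] by blast
  obtain e' where e': "e' \<in> Poly_Mapping.keys q" "w e' = weighted_degree w q" using weighted_degree_attained[OF nz(2)] by blast
  let ?c = "Poly_Mapping.lookup p e" and ?c' = "Poly_Mapping.lookup q e'"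
  define p' where "p' = p - Poly_Mapping.single e ?c"
  define q' where "q' = q - Poly_Mapping.single e' ?c'"
  have p': "w k < w e" if "k \<in> Poly_Mapping.keys p'" for k
  proof -
    have "k \<noteq> e" "k \<in> Poly_Mapping.keys p"
      using that by (auto simp: p'_def in_keys_iff lookup_minus lookup_single when_def split: if_splits)
    then show ?thesis using weighted_degree_ge[of k p w] e inj by (metis injD order_le_neq_trans)
  qed
  have q': "w k < w e'" if "k \<in> Poly_Mapping.keys q'" for k
  proof -
    have "k \<noteq> e'" "k \<in> Poly_Mapping.keys q"
      using that by (auto simp: q'_def in_keys_iff lookup_minus lookup_single when_def split: if_splits)
    then show ?thesis using weighted_degree_ge[of k q w] e' inj by (metis injD order_le_neq_trans)
  qed
  \<comment> \<open>Here \<open>p'\<close> and \<open>q'\<close> are \<open>p\<close> and \<open>q\<close> without their leading terms.\<close>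
  have keysmult: "w k < w e + w e'" if "k \<in> Poly_Mapping.keys (r * s)"
    and "\<And>i j. i \<in> Poly_Mapping.keys r \<Longrightarrow> j \<in> Poly_Mapping.keys s \<Longrightarrow> w i + w j < w e + w e'"
    for k and r s :: "'e \<Rightarrow>\<^sub>0 'b"
    using that keys_mult[of r s] by (fastforce simp: w)
  define rest where "rest = Poly_Mapping.single e ?c * q' + p' * q"
  have rest: "w k < w e + w e'" if k: "k \<in> Poly_Mapping.keys rest" for k
  proof -
    consider "k \<in> Poly_Mapping.keys (Poly_Mapping.single e ?c * q')" | "k \<in> Poly_Mapping.keys (p' * q)"
      using k keys_add[of "Poly_Mapping.single e ?c * q'" "p' * q"] unfolding rest_def by blast
    then show ?thesis
    proof cases
      case 1
      then show ?thesis by (rule keysmult) (use q' in \<open>auto split: if_splits\<close>)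
    next
      case 2
      then show ?thesis
        by (rule keysmult) (use p' e' weighted_degree_ge[of _ q w] in \<open>auto intro: add_less_le_mono\<close>)
    qed
  qed
  have eq: "p * q = Poly_Mapping.single (e + e') (?c * ?c') + rest"
  proof -
    have "Poly_Mapping.single (e + e') (?c * ?c') = Poly_Mapping.single e ?c * Poly_Mapping.single e' ?c'"
      by (simp add: mult_single)
    then show ?thesis by (simp add: rest_def p'_def q'_def algebra_simps)
  qed
  have key: "e + e' \<in> Poly_Mapping.keys (p * q)"
  proof -
    have "e + e' \<notin> Poly_Mapping.keys rest" using rest[of "e + e'"] by (auto simp: w)
    then show ?thesis using e e' by (simp add: eq in_keys_iff lookup_add)
  qed
  have "w k \<le> w e + w e'" if "k \<in> Poly_Mapping.keys (p * q)" for k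
    using that keys_add[of "Poly_Mapping.single (e + e') (?c * ?c')" rest] rest[of k]
    by (auto simp: eq w split: if_splits)
  then have "weighted_degree w (p * q) = w (e + e')"
    unfolding weighted_degree_def using imageI[OF key, of w] by (intro Max_eqI) (auto simp: w)
  then show ?thesis by (simp add: w e e')
qed

lemma keys_singleton_imp_single:
  fixes p :: "'e \<Rightarrow>\<^sub>0 'b::comm_monoid_add"
  assumes "p \<noteq> 0" and "\<And>k. k \<in> Poly_Mapping.keys p \<Longrightarrow> k = e"
  shows "\<exists>c. c \<noteq> 0 \<and> p = Poly_Mapping.single e c"
proof -
  have "Poly_Mapping.keys p \<noteq> {}" using assms(1) by (metis poly_mapping_sum_single sum.empty)
  then have k: "Poly_Mapping.keys p = {e}" using assms(2) by blast
  then have "p = Poly_Mapping.single e (Poly_Mapping.lookup p e)"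
    using poly_mapping_sum_single[of p] by simp
  moreover have "Poly_Mapping.lookup p e \<noteq> 0" using k in_keys_iff[of e p] by simp
  ultimately show ?thesis by blast
qed

text \<open>
  The largest exponents of \<open>p\<close> and \<open>q\<close> add up to \<open>0\<close>, and so do the smallest ones. Hence the width
  of the support of \<open>p\<close> and that of \<open>q\<close> add up to \<open>0\<close>, and both vanish.
\<close>

lemma laurent_unit_is_monomial:
  fixes p q :: "'e::linordered_ab_group_add \<Rightarrow>\<^sub>0 'b::idom"
  assumes "p * q = 1"
  shows "\<exists>e c. c \<noteq> 0 \<and> p = Poly_Mapping.single e c"
proof -
  have nz: "p \<noteq> 0" "q \<noteq> 0" using assms by auto
  have 1: "weighted_degree id p + weighted_degree id q = 0"
    using weighted_degree_mult[of id p q] nz assms by (simp add: weighted_degree_def)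
  have 2: "weighted_degree uminus p + weighted_degree uminus q = 0"
    using weighted_degree_mult[of uminus p q] nz assms by (simp add: weighted_degree_def)
  have width: "0 \<le> weighted_degree id r + weighted_degree uminus r" if nz: "r \<noteq> 0" for r :: "'e \<Rightarrow>\<^sub>0 'b"
  proof -
    obtain k where k: "k \<in> Poly_Mapping.keys r" using weighted_degree_attained[OF nz, of id] by blast
    then show ?thesis using add_mono[OF weighted_degree_ge[OF k, of id] weighted_degree_ge[OF k, of uminus]] by simp
  qed
  have 3: "weighted_degree id p + weighted_degree uminus p \<le> 0"
  proof -
    have "(weighted_degree id p + weighted_degree uminus p) + (weighted_degree id q + weighted_degree uminus q) = 0"
      using arg_cong2[OF 1 2, of "(+)"] by (simp add: add_ac)
    then have "weighted_degree id p + weighted_degree uminus p = - (weighted_degree id q + weighted_degree uminus q)"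
      by (simp only: eq_neg_iff_add_eq_0)
    also have "\<dots> \<le> 0" using width[OF nz(2)] by (simp only: neg_le_0_iff_le)
    finally show ?thesis .
  qed
  have "k = weighted_degree id p" if "k \<in> Poly_Mapping.keys p" for k
  proof (rule antisym)
    show "k \<le> weighted_degree id p" using weighted_degree_ge[OF that, of id] by simp
    have "- k \<le> weighted_degree uminus p" using weighted_degree_ge[OF that, of uminus] by simp
    also have "\<dots> \<le> - weighted_degree id p"
      using add_right_mono[OF 3, of "- weighted_degree id p"] by simp
    finally show "weighted_degree id p \<le> k" by simp
  qed
  from keys_singleton_imp_single[OF nz(1) this] show ?thesis by blast
qed

lemma monomial_dvd_1:
  fixes e :: "'e::ab_group_add" and c :: "'b::field"
  assumes "c \<noteq> 0"
  shows "Poly_Mapping.single e c dvd 1"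
proof
  show "1 = Poly_Mapping.single e c * Poly_Mapping.single (- e) (inverse c)"
    using assms by (simp add: mult_single)
qed

text \<open>
  The exponents are those of \<open>M, t, s\<close>: the lemma concerns \<open>(M\<^sup>2 s\<^sup>2)\<^sup>m - 1\<close>, also for negative \<open>m\<close>.
\<close>

lemma monomial_minus_1_dvd:
  "(Poly_Mapping.single (2, 0, 2) 1 - 1 :: laurent3) dvd Poly_Mapping.single (2 * m, 0, 2 * m) 1 - 1"
proof -
  let ?d = "Poly_Mapping.single (2, 0, 2) 1 - 1 :: laurent3"
  have nat: "?d dvd Poly_Mapping.single (2 * int n, 0, 2 * int n) 1 - 1" for n
  proof (induction n)
    case 0
    then show ?case by (simp flip: zero_prod_def)
  next
    case (Suc n)
    have "Poly_Mapping.single (2 * int (Suc n), 0, 2 * int (Suc n)) 1 - 1 =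
        Poly_Mapping.single (2, 0, 2) 1 * (Poly_Mapping.single (2 * int n, 0, 2 * int n) 1 - 1) + ?d"
      unfolding right_diff_distrib mult_single by simp
    with Suc show ?case by (simp only: dvd_add dvd_mult dvd_refl)
  qed
  show ?thesis
  proof (cases "m \<ge> 0")
    case True
    then show ?thesis using nat[of "nat m"] by simp
  next
    case False
    then have "?d dvd Poly_Mapping.single (- (2 * m), 0, - (2 * m)) 1 - 1"
      using nat[of "nat (- m)"] by simp
    then have "?d dvd - Poly_Mapping.single (2 * m, 0, 2 * m) 1 *
        (Poly_Mapping.single (- (2 * m), 0, - (2 * m)) 1 - 1)"
      by (rule dvd_mult)
    also have "\<dots> = Poly_Mapping.single (2 * m, 0, 2 * m) 1 - 1"
      unfolding right_diff_distrib mult_minus_left mult_single by (simp add: zero_prod_def[symmetric])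
    finally show ?thesis .
  qed
qed

text \<open>
  The coprimality of \<open>E = M\<^sup>2 s\<^sup>2 - 1\<close> and \<open>F = M\<^sup>2 t\<^sup>2 - 1\<close>, in a form that avoids greatest common
  divisors. Moving every exponent along multiples of \<open>(2, 0, 2)\<close> until the exponent of \<open>s\<close> is \<open>0\<close>
  or \<open>1\<close> is a normal form modulo \<open>E\<close>. It kills the multiples of \<open>E\<close> and commutes with
  multiplication by \<open>F\<close>, so it sends \<open>a F\<close>, a multiple of \<open>E\<close>, to \<open>0\<close>, and hence \<open>a\<close> too.
\<close>

lemma cross_multiples_of_coprime_binomials:
  fixes a b :: laurent3
  assumes eq: "a * (Poly_Mapping.single (2, 2, 0) 1 - 1) = b * (Poly_Mapping.single (2, 0, 2) 1 - 1)"
  shows "\<exists>g. a = g * (Poly_Mapping.single (2, 0, 2) 1 - 1) \<and> b = g * (Poly_Mapping.single (2, 2, 0) 1 - 1)"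
proof -
  let ?E = "Poly_Mapping.single (2, 0, 2) 1 - 1 :: laurent3"
  let ?F = "Poly_Mapping.single (2, 2, 0) 1 - 1 :: laurent3"
  let ?\<phi> = "\<lambda>(i, j, k). (i - 2 * (k div 2), j, k mod 2) :: int \<times> int \<times> int"
  have nz: "?E \<noteq> 0" "?F \<noteq> 0"
    by (rule notI, drule arg_cong[where f = "\<lambda>p. Poly_Mapping.lookup p 0"],
        simp add: lookup_minus lookup_single lookup_one zero_prod_def)+
  have cong: "?E dvd p - monomial_subst ?\<phi> p" for p
  proof (induction p rule: poly_mapping_single_add_induct)
    case (single e c)
    obtain i j k where e: "e = (i, j, k)" by (cases e)
    have "Poly_Mapping.single e c - monomial_subst ?\<phi> (Poly_Mapping.single e c) =
        Poly_Mapping.single (?\<phi> e) c * (Poly_Mapping.single (2 * (k div 2), 0, 2 * (k div 2)) 1 - 1)"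
      by (simp add: e right_diff_distrib mult_single)
    then show ?case by (simp only: dvd_mult monomial_minus_1_dvd)
  next
    case (add p q)
    have "p + q - monomial_subst ?\<phi> (p + q) = (p - monomial_subst ?\<phi> p) + (q - monomial_subst ?\<phi> q)"
      by (simp add: monomial_subst_add)
    with add show ?case by (simp only: dvd_add)
  qed
  have kill: "monomial_subst ?\<phi> (p * ?E) = 0" for p
  proof (induction p rule: poly_mapping_single_add_induct)
    case (single e c)
    then show ?case
      by (cases e) (simp add: right_diff_distrib mult_single monomial_subst_diff)
  qed (simp add: distrib_right monomial_subst_add)
  have pass: "monomial_subst ?\<phi> (p * ?F) = monomial_subst ?\<phi> p * ?F" for p
  proof (induction p rule: poly_mapping_single_add_induct)
    case (single e c)
    then show ?case
      by (cases e) (simp add: right_diff_distrib mult_single monomial_subst_diff algebra_simps)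
  qed (simp add: distrib_right monomial_subst_add)
  have "monomial_subst ?\<phi> a * ?F = 0" using pass[of a] kill[of b] eq by simp
  then have "monomial_subst ?\<phi> a = 0" using nz(2) by (simp only: mult_eq_0_iff simp_thms)
  then have "?E dvd a" using cong[of a] by simp
  then obtain g where g: "a = g * ?E" unfolding dvd_def by (metis mult.commute)
  have "?E * b = ?E * (g * ?F)" using eq unfolding g by (simp only: mult_ac)
  then have "b = g * ?F" using nz(1) by (simp only: mult_cancel_left simp_thms)
  with g show ?thesis by blast
qed

lemma irreducible_unit_mult:
  fixes u p :: "'a::idom"
  assumes "u dvd 1" "irreducible p"
  shows "irreducible (u * p)"
proof (rule irreducibleI)
  from assms(1) obtain v where v: "1 = u * v" by (elim dvdE)
  show "u * p \<noteq> 0" using assms v by (auto simp: irreducible_def)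
  show "\<not> u * p dvd 1" using assms(2) by (auto simp: irreducible_def dest: dvd_mult_right)
  fix a b assume "u * p = a * b"
  then have "p = (v * a) * b" using v by (metis mult.assoc mult.commute mult_1)
  then show "a dvd 1 \<or> b dvd 1" using assms(2) by (metis irreducible_def dvd_mult_right)
qed

text \<open>
  In a factorization the widths in the direction of \<open>x\<close> add up to \<open>1\<close>, so one factor has width \<open>0\<close>.
  All its terms then have the largest exponent of \<open>x\<close>. The terms of \<open>Q\<close> of the largest exponent of
  \<open>x\<close> form a single monomial, so this factor also has height \<open>0\<close>: it is a monomial, a unit.
\<close>

lemma irreducible_newton_triangle:
  fixes Q :: laurent2
  assumes keys: "Poly_Mapping.keys Q = {(0, 2), (0, 0), (1, m)}"
  shows "irreducible Q"
proof (rule irreducibleI)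
  show Qnz: "Q \<noteq> 0" using keys by auto
  show "\<not> Q dvd 1"
  proof
    assume "Q dvd 1"
    then obtain r where "Q * r = 1" by (metis dvdE)
    from laurent_unit_is_monomial[OF this] obtain e c where "Q = Poly_Mapping.single e c" by blast
    then have "Poly_Mapping.keys Q \<subseteq> {e}" by simp
    then show False unfolding keys by auto
  qed
  fix p q assume pq: "Q = p * q"
  \<comment> \<open>The order \<open>?w\<close> finds the lowest term among those of the largest exponent of \<open>x\<close>, where \<open>id\<close> finds the highest.\<close>
  let ?w = "\<lambda>(i, j). (i, - j) :: int \<times> int"
  have nz: "p \<noteq> 0" "q \<noteq> 0" using pq Qnz by auto
  have max1: "weighted_degree id p + weighted_degree id q = (1, m)"
    and max2: "weighted_degree uminus p + weighted_degree uminus q = (0, 0)"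
    and max3: "weighted_degree ?w p + weighted_degree ?w q = (1, - m)"
  proof -
    have "weighted_degree id (p * q) = (1, m)" "weighted_degree uminus (p * q) = (0, 0)" "weighted_degree ?w (p * q) = (1, - m)"
      unfolding pq[symmetric] weighted_degree_def keys by (auto intro!: Max_eqI)
    moreover have "weighted_degree id (p * q) = weighted_degree id p + weighted_degree id q"
      "weighted_degree uminus (p * q) = weighted_degree uminus p + weighted_degree uminus q"
      "weighted_degree ?w (p * q) = weighted_degree ?w p + weighted_degree ?w q"
      using nz by (intro weighted_degree_mult; force simp: inj_def)+
    ultimately show "weighted_degree id p + weighted_degree id q = (1, m)"
      "weighted_degree uminus p + weighted_degree uminus q = (0, 0)" "weighted_degree ?w p + weighted_degree ?w q = (1, - m)" by simp_all
  qed
  have shape: "0 \<le> fst (weighted_degree id r) + fst (weighted_degree uminus r)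
      \<and> fst (weighted_degree ?w r) = fst (weighted_degree id r) \<and> 0 \<le> snd (weighted_degree id r) + snd (weighted_degree ?w r)"
    if r: "r \<noteq> 0" for r :: laurent2
  proof -
    obtain k1 where k1: "k1 \<in> Poly_Mapping.keys r" "id k1 = weighted_degree id r" using weighted_degree_attained[OF r] by blast
    obtain k3 where k3: "k3 \<in> Poly_Mapping.keys r" "?w k3 = weighted_degree ?w r" using weighted_degree_attained[OF r] by blast
    show ?thesis
      using weighted_degree_ge[OF k1(1), of uminus] weighted_degree_ge[OF k1(1), of ?w] weighted_degree_ge[OF k3(1), of id]
      unfolding k1(2)[symmetric] k3(2)[symmetric]
      by (cases k1; cases k3; cases "weighted_degree uminus r") (auto simp: k1(2)[symmetric] k3(2)[symmetric])
  qed
  have unit: "r dvd 1" if r: "r \<noteq> 0" and flat: "fst (weighted_degree id r) + fst (weighted_degree uminus r) = 0"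
      and thin: "snd (weighted_degree id r) + snd (weighted_degree ?w r) = 0" for r :: laurent2
  proof -
    have "k = weighted_degree id r" if k: "k \<in> Poly_Mapping.keys r" for k
      using weighted_degree_ge[OF k, of id] weighted_degree_ge[OF k, of uminus] weighted_degree_ge[OF k, of ?w] flat thin shape[OF r]
      by (cases k; cases "weighted_degree id r"; cases "weighted_degree uminus r"; cases "weighted_degree ?w r") auto
    from keys_singleton_imp_single[OF r this] obtain c where "c \<noteq> 0" "r = Poly_Mapping.single (weighted_degree id r) c"
      by blast
    then show ?thesis by (metis monomial_dvd_1)
  qed
  have "snd (weighted_degree id p) + snd (weighted_degree ?w p) + (snd (weighted_degree id q) + snd (weighted_degree ?w q)) = 0"
    "fst (weighted_degree id p) + fst (weighted_degree uminus p) + (fst (weighted_degree id q) + fst (weighted_degree uminus q)) = 1"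
    using arg_cong[OF max1, of fst] arg_cong[OF max1, of snd] arg_cong[OF max2, of fst]
      arg_cong[OF max3, of snd] by simp_all
  then show "p dvd 1 \<or> q dvd 1"
    using shape[OF nz(1)] shape[OF nz(2)] unit[OF nz(1)] unit[OF nz(2)] by linarith
qed

text \<open>The polynomial \<open>y\<^sup>2 - 1 - \<sigma> x y\<^sup>m\<close>.\<close>

definition trinomial :: "rat \<Rightarrow> int \<Rightarrow> laurent2" where
  "trinomial \<sigma> m = Poly_Mapping.single (0, 2) 1 - 1 - Poly_Mapping.single (1, m) \<sigma>"

lemma irreducible_trinomial:
  fixes \<sigma> :: rat
  assumes "\<sigma> \<noteq> 0"
  shows "irreducible (trinomial \<sigma> m)" (is "irreducible ?Q")
proof (rule irreducible_newton_triangle[of _ m], rule set_eqI)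
  fix k :: "int \<times> int"
  obtain i j where k: "k = (i, j)" by (cases k)
  have "Poly_Mapping.lookup ?Q k = (if k = (0, 2) then 1 else 0) - (if k = (0, 0) then 1 else 0)
      - (if k = (1, m) then \<sigma> else 0)"
    by (simp add: trinomial_def lookup_minus lookup_single lookup_one when_def zero_prod_def eq_commute[of k])
  then show "k \<in> Poly_Mapping.keys ?Q \<longleftrightarrow> k \<in> {(0, 2), (0, 0), (1, m)}"
    using assms unfolding in_keys_iff by (cases "k = (1, m)") simp_all
qed

section \<open>Laurent polynomials as rational functions\<close>

lemma q_half_nz [simp]: "q_half \<noteq> 0" and a_half_nz [simp]: "a_half \<noteq> 0"
  by (simp_all add: q_half_def a_half_def)

lemma to_fract_power: "to_fract (x ^ n) = to_fract x ^ n"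
  by (induction n) simp_all

lemma to_fract_of_int: "to_fract (of_int n) = of_int n"
proof -
  have "to_fract (of_nat m) = (of_nat m :: 'a fract)" for m
    by (induction m) simp_all
  then show ?thesis by (cases n) (simp_all add: to_fract_uminus del: of_nat_Suc)
qed

lemma of_rat_ratfun: "(of_rat c :: ratfun) = to_fract [:[:c:]:]"
proof -
  obtain a b where c: "c = of_int a / of_int b" and b: "b > 0"
    using Rat_cases[of c] by (metis Fract_of_int_quotient)
  have "to_fract [:[:c:]:] * of_int b = to_fract ([:[:c:]:] * of_int b)"
    by (simp only: to_fract_mult to_fract_of_int)
  also have "[:[:c:]:] * of_int b = (of_int a :: rat poly poly)"
    using b by (simp add: c of_int_poly)
  finally have "to_fract [:[:c:]:] = (of_int a / of_int b :: ratfun)"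
    using b by (simp add: to_fract_of_int field_simps)
  then show ?thesis by (simp add: c of_rat_divide)
qed

lemma to_fract_monom: "to_fract (monom (monom c k) j) = of_rat c * a_half ^ j * q_half ^ k"
proof -
  have "monom (monom c k) j = [:[:c:]:] * [:0, 1:] ^ j * [:[:0, 1:]:] ^ k"
  proof -
    have "[:[:0, 1 :: rat:]:] ^ k = [:[:0, 1:] ^ k:]"
      by (induction k) simp_all
    then show ?thesis by (simp add: monom_altdef[of c] monom_altdef[of _ j] mult.commute)
  qed
  then show ?thesis
    by (simp only: of_rat_ratfun a_half_def q_half_def to_fract_power to_fract_mult)
qed

text \<open>The exponents refer to \<open>t\<close> and \<open>s\<close>, in this order.\<close>

definition ratfun_of_laurent :: "laurent2 \<Rightarrow> ratfun" where
  "ratfun_of_laurent = lin_ext (\<lambda>(j, k) c. of_rat c * a_half powi j * q_half powi k)"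

lemma ratfun_of_laurent_mult: "ratfun_of_laurent (p * p') = ratfun_of_laurent p * ratfun_of_laurent p'"
  unfolding ratfun_of_laurent_def
  by (rule lin_ext_mult) (auto simp: of_rat_add of_rat_mult distrib_right power_int_add)

lemma ratfun_of_laurent_add: "ratfun_of_laurent (p + p') = ratfun_of_laurent p + ratfun_of_laurent p'"
  unfolding ratfun_of_laurent_def
  by (rule lin_ext_add) (auto simp: of_rat_add distrib_right)

lemma ratfun_of_laurent_single: "ratfun_of_laurent (Poly_Mapping.single (j, k) c) = of_rat c * a_half powi j * q_half powi k"
  unfolding ratfun_of_laurent_def by (subst lin_ext_single) auto

lemma ratfun_of_laurent_diff: "ratfun_of_laurent (p - p') = ratfun_of_laurent p - ratfun_of_laurent p'"
  using ratfun_of_laurent_add[of "p - p'" p'] by (simp add: algebra_simps)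

text \<open>
  Multiplication by a large power of \<open>t s\<close> turns a Laurent polynomial into a polynomial, whose
  coefficients are visible in the fraction field.
\<close>

lemma ratfun_of_laurent_eq_0: 
  assumes "ratfun_of_laurent p = 0"
  shows "p = 0"
proof -
  \<comment> \<open>The \<open>0\<close> only serves to make the maximum exist when \<open>p\<close> has no terms.\<close>
  define N where "N = Max (insert 0 ((\<lambda>(j, k). max (- j) (- k)) ` Poly_Mapping.keys p))"
  have N: "0 \<le> j + N \<and> 0 \<le> k + N" if "(j, k) \<in> Poly_Mapping.keys p" for j k
  proof -
    have "max (- j) (- k) \<le> N"
      unfolding N_def using that by (intro Max_ge) (auto intro!: rev_image_eqI)
    then show ?thesis by simp
  qed
  define P where "P = (\<Sum>(j, k)\<in>Poly_Mapping.keys p. monom (monom (Poly_Mapping.lookup p (j, k)) (nat (k + N))) (nat (j + N)))"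
  have "to_fract P = (\<Sum>(j, k)\<in>Poly_Mapping.keys p.
      to_fract (monom (monom (Poly_Mapping.lookup p (j, k)) (nat (k + N))) (nat (j + N))))"
    unfolding P_def by (induction rule: infinite_finite_induct) (auto simp: case_prod_unfold)
  also have "\<dots> = (\<Sum>(j, k)\<in>Poly_Mapping.keys p.
      a_half powi N * q_half powi N * (of_rat (Poly_Mapping.lookup p (j, k)) * a_half powi j * q_half powi k))"
    using N by (intro sum.cong refl)
      (auto simp: to_fract_monom power_int_add simp flip: power_int_of_nat)
  also have "\<dots> = a_half powi N * q_half powi N * ratfun_of_laurent p"
    by (simp add: ratfun_of_laurent_def lin_ext_def sum_distrib_left case_prod_unfold)
  finally have P0: "P = 0" using assms by simp
  have "Poly_Mapping.lookup p (j, k) = 0" if jk: "(j, k) \<in> Poly_Mapping.keys p" for j k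
  proof -
    have "coeff (coeff P (nat (j + N))) (nat (k + N)) =
        (\<Sum>e\<in>Poly_Mapping.keys p. if e = (j, k) then Poly_Mapping.lookup p (j, k) else 0)"
      unfolding P_def coeff_sum using N N[OF jk] by (intro sum.cong refl) (auto dest!: N simp: eq_nat_nat_iff split: if_splits)
    also have "\<dots> = Poly_Mapping.lookup p (j, k)"
      using jk by simp
    finally show ?thesis by (simp add: P0)
  qed
  then show ?thesis by (intro poly_mapping_eqI) (metis in_keys_iff lookup_zero surj_pair)
qed

lemma ratfun_of_laurent_nz:
  assumes "p \<noteq> 0" "ratfun_of_laurent p = x"
  shows "x \<noteq> 0"
  using assms ratfun_of_laurent_eq_0 by blast

lemma q_half_diff_nz: "k \<noteq> l \<Longrightarrow> q_half powi k - q_half powi l \<noteq> 0"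
proof (rule ratfun_of_laurent_nz)
  assume "k \<noteq> l"
  then show "Poly_Mapping.single (0, k) 1 - Poly_Mapping.single (0, l) 1 \<noteq> (0 :: laurent2)"
    by (intro notI, drule_tac arg_cong[where f = "\<lambda>p. Poly_Mapping.lookup p (0, k)"])
      (simp add: lookup_minus lookup_single)
qed (simp add: ratfun_of_laurent_diff ratfun_of_laurent_single)

lemma a_half_diff_nz:
  assumes "i \<noteq> j"
  shows "a_half powi i * q_half powi k - a_half powi j * q_half powi l \<noteq> 0"
proof (rule ratfun_of_laurent_nz)
  show "Poly_Mapping.single (i, k) 1 - Poly_Mapping.single (j, l) 1 \<noteq> (0 :: laurent2)"
    using assms
    by (intro notI, drule_tac arg_cong[where f = "\<lambda>p. Poly_Mapping.lookup p (i, k)"])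
      (simp add: lookup_minus lookup_single)
qed (simp add: ratfun_of_laurent_diff ratfun_of_laurent_single)

text \<open>
  Evaluation at \<open>M = s\<^sup>n\<close> factors through Laurent polynomials in \<open>t, s\<close> and is therefore a ring
  homomorphism.
\<close>

lemma coeff_at_conv_ratfun_of_laurent:
  "coeff_at p n = ratfun_of_laurent (monomial_subst (\<lambda>(i, j, k). (j, int n * i + k)) p)"
proof (induction p rule: poly_mapping_single_add_induct)
  case (single e c)
  then show ?case
    by (cases e) (auto simp: coeff_at_def ratfun_of_laurent_single power_int_add power_int_mult)
next
  case (add p q)
  have "coeff_at r n = lin_ext (\<lambda>(i, j, k) c. of_rat c * (q_half ^ n) powi i * a_half powi j * q_half powi k) r"
    for r by (simp add: coeff_at_def lin_ext_def case_prod_unfold)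
  then have "coeff_at (p + q) n = coeff_at p n + coeff_at q n"
    by (simp only:) (rule lin_ext_add; simp add: case_prod_unfold of_rat_add distrib_right)
  with add show ?case by (simp add: monomial_subst_add ratfun_of_laurent_add)
qed

lemma coeff_at_diff: "coeff_at (p - p') n = coeff_at p n - coeff_at p' n"
  by (simp add: coeff_at_conv_ratfun_of_laurent monomial_subst_diff ratfun_of_laurent_diff)

lemma coeff_at_mult: "coeff_at (p * p') n = coeff_at p n * coeff_at p' n"
  by (simp add: coeff_at_conv_ratfun_of_laurent monomial_subst_mult ratfun_of_laurent_mult case_prod_unfold algebra_simps)

lemma coeff_at_single:
  "coeff_at (Poly_Mapping.single (i, j, k) c) n = of_rat c * a_half powi j * q_half powi (int n * i + k)"
  by (simp add: coeff_at_conv_ratfun_of_laurent ratfun_of_laurent_single)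

text \<open>
  For large \<open>n\<close> the substitution \<open>M = s\<^sup>n\<close> sends the finitely many monomials of \<open>p\<close> to distinct
  monomials in \<open>t, s\<close>, so nothing can cancel.
\<close>

lemma coeff_at_infinitely_often_0:
  assumes "infinite {n. coeff_at p n = 0}"
  shows "p = 0"
proof (rule ccontr)
  assume "p \<noteq> 0"
  \<comment> \<open>If \<open>n > 2 B\<close>, then \<open>n i + k\<close> determines \<open>i\<close> and \<open>k\<close>, because \<open>k\<close> ranges over an interval of length \<open>2 B\<close>.\<close>
  define B where "B = Max (insert 0 ((\<lambda>(i, j, k). \<bar>k\<bar>) ` Poly_Mapping.keys p))"
  have B: "\<bar>k\<bar> \<le> B" if "(i, j, k) \<in> Poly_Mapping.keys p" for i j k
    unfolding B_def using that by (intro Max_ge) (auto intro!: rev_image_eqI)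
  obtain n where n: "n > nat (2 * B)" "coeff_at p n = 0"
    using assms infinite_nat_iff_unbounded[of "{n. coeff_at p n = 0}"] by blast
  let ?\<phi> = "\<lambda>(i, j, k). (j, int n * i + k) :: int \<times> int"
  have "inj_on ?\<phi> (Poly_Mapping.keys p)"
  proof (rule inj_onI)
    fix e e' assume e: "e \<in> Poly_Mapping.keys p" "e' \<in> Poly_Mapping.keys p" "?\<phi> e = ?\<phi> e'"
    obtain i j k i' j' k' where ee: "e = (i, j, k)" "e' = (i', j', k')" by (metis prod_cases3)
    have "\<bar>k\<bar> \<le> B" "\<bar>k'\<bar> \<le> B" using B e ee by blast+
    moreover have eq: "int n * (i - i') = k' - k" using e ee by (simp add: algebra_simps)
    ultimately have "\<bar>int n * (i - i')\<bar> < int n" using n by linarith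
    then have "\<bar>i - i'\<bar> < 1" by (simp add: abs_mult mult_less_cancel_left2)
    then show "e = e'" using eq e ee by simp
  qed
  moreover have "monomial_subst ?\<phi> p = 0"
    using n by (intro ratfun_of_laurent_eq_0) (simp add: coeff_at_conv_ratfun_of_laurent)
  moreover obtain e where "e \<in> Poly_Mapping.keys p" using \<open>p \<noteq> 0\<close> weighted_degree_attained by blast
  ultimately have "Poly_Mapping.lookup p e = 0"
    using lookup_monomial_subst_inj[of ?\<phi> p e] by simp
  with \<open>e \<in> Poly_Mapping.keys p\<close> show False by (simp add: in_keys_iff)
qed

lemma coeff_at_almost_all_0:
  assumes "finite {n. coeff_at p n \<noteq> 0}"
  shows "p = 0"
proof -
  have "{n. coeff_at p n = 0} = - {n. coeff_at p n \<noteq> 0}" by auto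
  then have "infinite {n. coeff_at p n = 0}" using assms by (simp only: finite_compl) simp
  then show ?thesis by (rule coeff_at_infinitely_often_0)
qed

section \<open>The quantum A-polynomial of the framed unknot\<close>

text \<open>
  The first-order recursion from which everything about the unknot follows: consecutive invariants
  differ by one factor of the product and by a shift of the framing factor.
\<close>

lemma framed_H_Suc:
  "(q_half powi (int n + 1) - q_half powi (- (int n + 1))) * framed_H \<tau> (Suc n)
   = (-1) powi \<tau> * q_half powi (2 * int n * \<tau>)
     * (a_half * q_half powi int n - inverse a_half * q_half powi (- int n)) * framed_H \<tau> n"
proof -
  define d where "d = q_half powi (int n + 1) - q_half powi (- (int n + 1))"
  have d: "d \<noteq> 0"
    unfolding d_def by (rule q_half_diff_nz) simp
  have 1: "unknot_H (Suc n) = unknot_H n * ((a_half * q_half powi int n - inverse a_half * q_half powi (- int n))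
       / (q_half powi (int n + 1) - q_half powi (- (int n + 1))))"
  proof -
    have "int (Suc n) = int n + 1" "\<not> Suc n < 1" by simp_all
    then show ?thesis
      by (simp only: unknot_H_def prod.cl_ivl_Suc if_False add_diff_cancel_right')
  qed
  have 2: "int (Suc n) * \<tau> = \<tau> + int n * \<tau>"
    "int (Suc n) * (int (Suc n) - 1) * \<tau> = 2 * int n * \<tau> + int n * (int n - 1) * \<tau>"
    by (simp_all add: algebra_simps)
  show ?thesis
    unfolding framed_H_def 1 2 d_def[symmetric] using d by (simp add: power_int_add)
qed

lemma framed_H_nz: "framed_H \<tau> n \<noteq> 0"
proof (induction n)
  case 0
  show ?case by (simp add: framed_H_def unknot_H_def)
next
  case (Suc n)
  have "a_half powi 1 * q_half powi int n - a_half powi (-1) * q_half powi (- int n) \<noteq> 0"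
    by (rule a_half_diff_nz) simp
  then have "(-1) powi \<tau> * q_half powi (2 * int n * \<tau>)
     * (a_half * q_half powi int n - inverse a_half * q_half powi (- int n)) * framed_H \<tau> n \<noteq> 0"
    using Suc by (simp add: power_int_minus)
  then show ?case using framed_H_Suc[of n \<tau>] by auto
qed

definition unknot_a1 :: laurent3 where
  "unknot_a1 = Poly_Mapping.single (1, 0, 1) 1 - Poly_Mapping.single (-1, 0, -1) 1"

definition unknot_a0 :: "int \<Rightarrow> laurent3" where
  "unknot_a0 \<tau> = Poly_Mapping.single (2 * \<tau> - 1, -1, 0) ((-1) powi \<tau>)
     - Poly_Mapping.single (2 * \<tau> + 1, 1, 0) ((-1) powi \<tau>)"

text \<open>
  The recursion as an operator, with both coefficients on one side:
  \<open>(M s - M\<^sup>-\<^sup>1 s\<^sup>-\<^sup>1) L - (-1)\<^sup>\<tau> M\<^sup>2\<^sup>\<tau> (M t - M\<^sup>-\<^sup>1 t\<^sup>-\<^sup>1)\<close>.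
\<close>

definition unknot_operator :: "int \<Rightarrow> operator" where
  "unknot_operator \<tau> = [:unknot_a0 \<tau>, unknot_a1:]"

lemma of_rat_sign: "(of_rat ((-1) powi \<tau>) :: 'a::field_char_0) = (-1) powi \<tau>"
  by (simp add: power_int_minus_left of_rat_minus)

lemma coeff_at_unknot:
  "coeff_at unknot_a1 n = q_half powi (int n + 1) - q_half powi (- (int n + 1))"
  "coeff_at (unknot_a0 \<tau>) n = - ((-1) powi \<tau> * q_half powi (2 * int n * \<tau>)
     * (a_half * q_half powi int n - inverse a_half * q_half powi (- int n)))"
proof -
  show "coeff_at unknot_a1 n = q_half powi (int n + 1) - q_half powi (- (int n + 1))"
    by (simp add: unknot_a1_def coeff_at_diff coeff_at_single algebra_simps)
  have "int n * (2 * \<tau> + 1) = 2 * int n * \<tau> + int n" "int n * (2 * \<tau> - 1) = 2 * int n * \<tau> + - int n"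
    by (simp_all add: algebra_simps)
  then show "coeff_at (unknot_a0 \<tau>) n = - ((-1) powi \<tau> * q_half powi (2 * int n * \<tau>)
     * (a_half * q_half powi int n - inverse a_half * q_half powi (- int n)))"
    by (simp add: unknot_a0_def coeff_at_diff coeff_at_single of_rat_sign power_int_add power_int_diff
        power_int_minus divide_inverse right_diff_distrib mult_ac)
qed

lemma unknot_coefficients_nz: "unknot_a1 \<noteq> 0" "unknot_a0 \<tau> \<noteq> 0"
proof -
  have "Poly_Mapping.lookup unknot_a1 (1, 0, 1) = 1"
    by (simp add: unknot_a1_def lookup_minus lookup_single)
  then show "unknot_a1 \<noteq> 0" by auto
  have "Poly_Mapping.lookup (unknot_a0 \<tau>) (2 * \<tau> - 1, -1, 0) = (-1) powi \<tau>"
    by (simp add: unknot_a0_def lookup_minus lookup_single)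
  then show "unknot_a0 \<tau> \<noteq> 0" by auto
qed

lemma unknot_coefficients_factor:
  "unknot_a1 = Poly_Mapping.single (-1, 0, -1) 1 * (Poly_Mapping.single (2, 0, 2) 1 - 1)"
  "unknot_a0 \<tau> = - Poly_Mapping.single (2 * \<tau> - 1, -1, 0) ((-1) powi \<tau>) * (Poly_Mapping.single (2, 2, 0) 1 - 1)"
  by (simp_all add: unknot_a1_def unknot_a0_def right_diff_distrib mult_single add.commute)

lemma cross_multiples_of_unknot_coefficients:
  assumes "b1 * unknot_a0 \<tau> = b0 * unknot_a1"
  shows "\<exists>g. b1 = g * unknot_a1 \<and> b0 = g * unknot_a0 \<tau>"
proof -
  let ?E = "Poly_Mapping.single (2, 0, 2) 1 - 1 :: laurent3"
  let ?F = "Poly_Mapping.single (2, 2, 0) 1 - 1 :: laurent3"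
  let ?\<sigma> = "(-1) powi \<tau> :: rat"
  let ?v = "Poly_Mapping.single (- 1, 0, - 1) 1 :: laurent3" and ?v' = "Poly_Mapping.single (1, 0, 1) 1 :: laurent3"
  let ?u = "- Poly_Mapping.single (2 * \<tau> - 1, - 1, 0) ?\<sigma> :: laurent3"
  let ?u' = "- Poly_Mapping.single (1 - 2 * \<tau>, 1, 0) ?\<sigma> :: laurent3"
  have ss: "?\<sigma> * ?\<sigma> = 1" by (simp flip: power_int_mult_distrib)
  have vv: "?v * ?v' = 1" "?u * ?u' = 1"
    using ss by (simp_all add: mult_single flip: zero_prod_def)
  have "(b1 * ?u) * ?F = (b0 * ?v) * ?E"
    using assms unfolding unknot_coefficients_factor by (simp only: mult_ac)
  from cross_multiples_of_coprime_binomials[OF this] obtain g where g: "b1 * ?u = g * ?E" "b0 * ?v = g * ?F" by blast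
  have "b1 = (b1 * ?u) * ?u' * (?v * ?v')" by (simp only: vv mult.assoc mult_1_right)
  also have "\<dots> = (g * ?u' * ?v') * unknot_a1" unfolding g(1) unknot_coefficients_factor by (simp only: mult_ac)
  finally have 1: "b1 = (g * ?u' * ?v') * unknot_a1" .
  have "b0 * unknot_a1 = (g * ?u' * ?v' * unknot_a0 \<tau>) * unknot_a1"
    using assms unfolding 1 by (simp only: mult_ac)
  then have "b0 = g * ?u' * ?v' * unknot_a0 \<tau>" using unknot_coefficients_nz(1) by (simp only: mult_cancel_right simp_thms)
  with 1 show ?thesis by blast
qed

lemma op_apply_degree_1:
  assumes "degree A \<le> 1"
  shows "op_apply A f n = coeff_at (coeff A 0) n * f n + coeff_at (coeff A 1) n * f (Suc n)"
proof -
  have c0: "coeff_at 0 n = 0" by (simp add: coeff_at_def)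
  have "op_apply A f n = (\<Sum>l\<le>1. coeff_at (coeff A l) n * f (n + l))"
    unfolding op_apply_def using assms
    by (intro sum.mono_neutral_left) (auto simp: coeff_eq_0 c0)
  then show ?thesis by (simp add: atMost_Suc numeral_2_eq_2)
qed

text \<open>
  An operator of order \<open>0\<close> multiplies by the values of a Laurent polynomial, and the invariants do
  not vanish.
\<close>

lemma annihilates_imp_degree:
  assumes "B \<noteq> 0" "annihilates B (framed_H \<tau>)"
  shows "1 \<le> degree B"
proof (rule ccontr)
  assume "\<not> 1 \<le> degree B"
  then have d: "degree B = 0" by simp
  have "op_apply B (framed_H \<tau>) n = coeff_at (coeff B 0) n * framed_H \<tau> n" for n
    by (simp add: op_apply_def d)
  then have "finite {n. coeff_at (coeff B 0) n \<noteq> 0}"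
    using assms(2) by (simp add: annihilates_def framed_H_nz)
  then have "coeff B 0 = 0" by (rule coeff_at_almost_all_0)
  then show False using assms(1) d by (metis leading_coeff_0_iff)
qed

text \<open>
  Eliminating the next invariant by the recursion turns annihilation of almost all terms into the
  vanishing of one Laurent polynomial at almost all \<open>M = s\<^sup>n\<close>.
\<close>

lemma annihilates_degree_1:
  assumes A: "degree A \<le> 1"
  shows "annihilates A (framed_H \<tau>) \<longleftrightarrow> coeff A 1 * unknot_a0 \<tau> = coeff A 0 * unknot_a1"
proof -
  have "coeff_at unknot_a1 n * op_apply A (framed_H \<tau>) n
      = coeff_at (coeff A 0 * unknot_a1 - coeff A 1 * unknot_a0 \<tau>) n * framed_H \<tau> n" for n
  proof -
    have "coeff_at unknot_a1 n * framed_H \<tau> (Suc n) = - coeff_at (unknot_a0 \<tau>) n * framed_H \<tau> n"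
      using framed_H_Suc[of n \<tau>] by (simp add: coeff_at_unknot)
    then show ?thesis
      unfolding op_apply_degree_1[OF A] coeff_at_diff coeff_at_mult by algebra
  qed
  moreover have "coeff_at unknot_a1 n \<noteq> 0" for n
    unfolding coeff_at_unknot by (rule q_half_diff_nz) simp
  ultimately have *: "op_apply A (framed_H \<tau>) n = 0 \<longleftrightarrow>
      coeff_at (coeff A 0 * unknot_a1 - coeff A 1 * unknot_a0 \<tau>) n = 0" for n
    using framed_H_nz by (metis mult_eq_0_iff)
  show ?thesis
  proof
    assume "annihilates A (framed_H \<tau>)"
    then have "finite {n. coeff_at (coeff A 0 * unknot_a1 - coeff A 1 * unknot_a0 \<tau>) n \<noteq> 0}"
      by (simp add: annihilates_def *)
    then have "coeff A 0 * unknot_a1 - coeff A 1 * unknot_a0 \<tau> = 0" by (rule coeff_at_almost_all_0)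
    then show "coeff A 1 * unknot_a0 \<tau> = coeff A 0 * unknot_a1" by simp
  next
    assume "coeff A 1 * unknot_a0 \<tau> = coeff A 0 * unknot_a1"
    then have "op_apply A (framed_H \<tau>) n = 0" for n unfolding * by (simp add: coeff_at_def)
    then show "annihilates A (framed_H \<tau>)" by (simp add: annihilates_def)
  qed
qed

text \<open>
  A minimal operator has order \<open>1\<close> and is proportional to the recursion. By coprimality of the two
  coefficients of the recursion the factor is a Laurent polynomial; it divides all coefficients, so
  it is a unit, and the units are the monomials.
\<close>

lemma quantum_A_polynomial_iff:
  "quantum_A_polynomial \<tau> A \<longleftrightarrow> (\<exists>e c. c \<noteq> 0 \<and> A = smult (Poly_Mapping.single e c) (unknot_operator \<tau>))"
proof
  assume A: "quantum_A_polynomial \<tau> A"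
  have nz: "unknot_operator \<tau> \<noteq> 0" by (simp add: unknot_operator_def unknot_coefficients_nz)
  have "annihilates (unknot_operator \<tau>) (framed_H \<tau>)"
    by (subst annihilates_degree_1) (simp_all add: unknot_operator_def mult.commute)
  then have deg: "degree A \<le> 1" using A nz unfolding quantum_A_polynomial_def
    by (metis degree_pCons_0 degree_pCons_le le_trans One_nat_def unknot_operator_def)
  with A have "coeff A 1 * unknot_a0 \<tau> = coeff A 0 * unknot_a1"
    by (simp add: quantum_A_polynomial_def annihilates_degree_1)
  from cross_multiples_of_unknot_coefficients[OF this] obtain g
    where g: "coeff A 1 = g * unknot_a1" "coeff A 0 = g * unknot_a0 \<tau>" by blast
  have Ag: "A = smult g (unknot_operator \<tau>)"
  proof (rule poly_eqI)
    fix l :: nat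
    consider "l = 0" | "l = 1" | "l > 1" by linarith
    then show "coeff A l = coeff (smult g (unknot_operator \<tau>)) l"
    proof cases
      case 3
      then show ?thesis using deg by (simp add: coeff_eq_0 unknot_operator_def)
    qed (use g in \<open>simp_all add: unknot_operator_def\<close>)
  qed
  then have "g dvd coeff A l" for l by simp
  then have "g dvd 1" using A by (simp add: quantum_A_polynomial_def)
  then obtain r where "g * r = 1" by (metis dvdE)
  from laurent_unit_is_monomial[OF this] Ag
  show "\<exists>e c. c \<noteq> 0 \<and> A = smult (Poly_Mapping.single e c) (unknot_operator \<tau>)" by blast
next
  assume "\<exists>e c. c \<noteq> 0 \<and> A = smult (Poly_Mapping.single e c) (unknot_operator \<tau>)"
  then obtain e c where c: "c \<noteq> 0" and A: "A = smult (Poly_Mapping.single e c) (unknot_operator \<tau>)" by blast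
  let ?u = "Poly_Mapping.single e c"
  have u: "?u dvd 1" using c by (rule monomial_dvd_1)
  then have unz: "?u \<noteq> 0" by (metis dvd_0_left_iff zero_neq_one)
  have coeff: "coeff A 0 = ?u * unknot_a0 \<tau>" "coeff A 1 = ?u * unknot_a1"
    by (simp_all add: A unknot_operator_def)
  have deg: "degree A \<le> 1" using unz by (simp add: A unknot_operator_def unknot_coefficients_nz)
  show "quantum_A_polynomial \<tau> A"
    unfolding quantum_A_polynomial_def
  proof (intro conjI allI impI)
    show "A \<noteq> 0" using unz by (simp add: A unknot_operator_def unknot_coefficients_nz)
    show "annihilates A (framed_H \<tau>)"
      unfolding annihilates_degree_1[OF deg] coeff by (simp only: mult_ac)
    show "degree A \<le> degree B" if "B \<noteq> 0 \<and> annihilates B (framed_H \<tau>)" for B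
      using that deg annihilates_imp_degree[of B \<tau>] by linarith
  next
    fix p assume "\<forall>l. p dvd coeff A l"
    then have "p dvd ?u * unknot_a0 \<tau>" "p dvd ?u * unknot_a1" by (metis coeff)+
    then obtain p0 p1 where p: "?u * unknot_a0 \<tau> = p * p0" "?u * unknot_a1 = p * p1" by (elim dvdE)
    have "?u * (p1 * unknot_a0 \<tau>) = p1 * (?u * unknot_a0 \<tau>)" by (simp only: mult_ac)
    also have "\<dots> = p0 * (?u * unknot_a1)" unfolding p by (simp only: mult_ac)
    also have "\<dots> = ?u * (p0 * unknot_a1)" by (simp only: mult_ac)
    finally have "p1 * unknot_a0 \<tau> = p0 * unknot_a1" using unz by (simp only: mult_cancel_left simp_thms)
    from cross_multiples_of_unknot_coefficients[OF this] obtain g where "p1 = g * unknot_a1" by blast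
    then have "unknot_a1 * ?u = unknot_a1 * (p * g)" using p(2) by (simp only: mult_ac)
    then have "?u = p * g" using unknot_coefficients_nz(1) by (simp only: mult_cancel_left simp_thms)
    then show "p dvd 1" using u by (metis dvd_mult_left)
  qed
qed

section \<open>The dual A-polynomial and its extremal limits\<close>

text \<open>
  The dual A-polynomial \<open>x\<^sup>-\<^sup>1 (y - y\<^sup>-\<^sup>1) - (-1)\<^sup>\<tau> (t y\<^sup>2\<^sup>\<tau>\<^sup>+\<^sup>1 - t\<^sup>-\<^sup>1 y\<^sup>2\<^sup>\<tau>\<^sup>-\<^sup>1)\<close>; the exponents refer to
  \<open>x, y, t\<close>.
\<close>

definition unknot_dual :: "int \<Rightarrow> laurent3" where
  "unknot_dual \<tau> =
     Poly_Mapping.single (-1, 1, 0) 1 - Poly_Mapping.single (-1, -1, 0) 1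
     + Poly_Mapping.single (0, 2 * \<tau> - 1, -1) ((-1) powi \<tau>)
     - Poly_Mapping.single (0, 2 * \<tau> + 1, 1) ((-1) powi \<tau>)"

lemma dual_of_unknot_operator:
  assumes "c \<noteq> 0"
  shows "monomial_subst (\<lambda>(i, l, j). (- l, i, j))
      (classical_limit (smult (Poly_Mapping.single (e1, e2, e3) c) (unknot_operator \<tau>)))
    = Poly_Mapping.single (0, e1, e2) c * unknot_dual \<tau>"
proof -
  let ?u = "Poly_Mapping.single (e1, e2, e3) c"
  have unz: "?u \<noteq> 0" using assms by (metis keys_single keys_zero insert_not_empty)
  have deg: "degree (smult ?u (unknot_operator \<tau>)) = 1"
    using unz by (simp add: unknot_operator_def unknot_coefficients_nz)
  have eq: "classical_limit (smult ?u (unknot_operator \<tau>)) =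
      monomial_subst (\<lambda>(i, j, k). (i, 0, j)) (?u * unknot_a0 \<tau>)
    + monomial_subst (\<lambda>(i, j, k). (i, 1, j)) (?u * unknot_a1)"
    unfolding classical_limit_def deg by (simp add: unknot_operator_def)
  show ?thesis
    unfolding eq
    by (simp add: unknot_a0_def unknot_a1_def unknot_dual_def right_diff_distrib distrib_left mult_single
        monomial_subst_add monomial_subst_diff algebra_simps)
qed

lemma dual_A_polynomial_iff:
  "dual_A_polynomial \<tau> D \<longleftrightarrow> monomial_equiv D (unknot_dual \<tau>)"
proof
  assume "dual_A_polynomial \<tau> D"
  then obtain e c e' c' where c: "c \<noteq> 0" "c' \<noteq> 0"
    and D: "D = Poly_Mapping.single e' c' * monomial_subst (\<lambda>(i, l, j). (- l, i, j))
      (classical_limit (smult (Poly_Mapping.single e c) (unknot_operator \<tau>)))"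
    unfolding dual_A_polynomial_def quantum_A_polynomial_iff monomial_equiv_def by blast
  obtain e1 e2 e3 where e: "e = (e1, e2, e3)" by (cases e)
  have "D = Poly_Mapping.single (e' + (0, e1, e2)) (c' * c) * unknot_dual \<tau>"
    unfolding D e dual_of_unknot_operator[OF c(1)] by (simp only: mult_single flip: mult.assoc)
  moreover have "c' * c \<noteq> 0" using c by simp
  ultimately show "monomial_equiv D (unknot_dual \<tau>)" unfolding monomial_equiv_def by blast
next
  assume "monomial_equiv D (unknot_dual \<tau>)"
  then obtain e c where c: "c \<noteq> 0" and D: "D = Poly_Mapping.single e c * unknot_dual \<tau>"
    unfolding monomial_equiv_def by blast
  let ?A = "smult (Poly_Mapping.single (0, 0, 0) 1) (unknot_operator \<tau>)"
  have "quantum_A_polynomial \<tau> ?A"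
    unfolding quantum_A_polynomial_iff by (intro exI[of _ "(0, 0, 0)"] exI[of _ 1]) simp
  moreover have "monomial_subst (\<lambda>(i, l, j). (- l, i, j)) (classical_limit ?A) = unknot_dual \<tau>"
    by (subst dual_of_unknot_operator) (simp_all flip: zero_prod_def)
  ultimately show "dual_A_polynomial \<tau> D"
    unfolding dual_A_polynomial_def monomial_equiv_def using c D by metis
qed

text \<open>
  It suffices to exhibit the part \<open>p\<^sub>0\<close> at one level \<open>m\<close> of the exponent of \<open>t\<close> that lies strictly
  beyond the rest.
\<close>

lemma extremal_limit_leading_part:
  fixes p\<^sub>0 rest :: laurent3
  assumes c: "c = 1 \<or> c = -1" and nz: "p\<^sub>0 \<noteq> 0"
    and top: "\<And>i j k. (i, j, k) \<in> Poly_Mapping.keys p\<^sub>0 \<Longrightarrow> k = m"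
    and rest: "\<And>i j k. (i, j, k) \<in> Poly_Mapping.keys rest \<Longrightarrow> c * k < c * m"
  shows "extremal_limit c (p\<^sub>0 + rest) = monomial_subst (\<lambda>(i, j, k). (i, j)) p\<^sub>0"
proof -
  let ?p = "p\<^sub>0 + rest"
  have disj: "e \<notin> Poly_Mapping.keys rest" if "e \<in> Poly_Mapping.keys p\<^sub>0" for e
    using that top rest by (cases e) fastforce
  have lookup: "Poly_Mapping.lookup ?p e = Poly_Mapping.lookup p\<^sub>0 e" if "e \<in> Poly_Mapping.keys p\<^sub>0" for e
    using disj[OF that] by (simp add: lookup_add in_keys_iff)
  have sub: "Poly_Mapping.keys p\<^sub>0 \<subseteq> Poly_Mapping.keys ?p"
    using lookup by (auto simp: in_keys_iff)
  have keys: "e \<in> Poly_Mapping.keys p\<^sub>0 \<or> e \<in> Poly_Mapping.keys rest" if "e \<in> Poly_Mapping.keys ?p" for e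
    using that keys_add[of p\<^sub>0 rest] by blast
  obtain i0 j0 k0 where e0: "(i0, j0, k0) \<in> Poly_Mapping.keys p\<^sub>0"
    using weighted_degree_attained[OF nz, of id] by (metis prod_cases3)
  have "Max ((\<lambda>(i, j, k). c * k) ` Poly_Mapping.keys ?p) = c * m"
  proof (rule Max_eqI)
    fix y assume "y \<in> (\<lambda>(i, j, k). c * k) ` Poly_Mapping.keys ?p"
    then obtain i j k where "(i, j, k) \<in> Poly_Mapping.keys ?p" "y = c * k" by auto
    then show "y \<le> c * m" using keys[of "(i, j, k)"] top[of i j k] rest[of i j k] by auto
  next
    show "c * m \<in> (\<lambda>(i, j, k). c * k) ` Poly_Mapping.keys ?p"
      using e0 sub top[OF e0] by (intro rev_image_eqI[of "(i0, j0, k0)"]) auto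
  qed simp
  then have m: "c * Max ((\<lambda>(i, j, k). c * k) ` Poly_Mapping.keys ?p) = m" using c by auto
  have "{(i, j, k) \<in> Poly_Mapping.keys ?p. k = m} = Poly_Mapping.keys p\<^sub>0"
  proof (intro equalityI subsetI)
    fix e assume "e \<in> {(i, j, k) \<in> Poly_Mapping.keys ?p. k = m}"
    then show "e \<in> Poly_Mapping.keys p\<^sub>0" using keys[of e] rest by auto
  next
    fix e assume e: "e \<in> Poly_Mapping.keys p\<^sub>0"
    obtain i j k where "e = (i, j, k)" by (cases e)
    then show "e \<in> {(i, j, k) \<in> Poly_Mapping.keys ?p. k = m}" using e sub top[of i j k] by auto
  qed
  then show ?thesis
    unfolding extremal_limit_def Let_def m monomial_subst_def
    using lookup by (auto intro!: sum.cong)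
qed

text \<open>
  After \<open>x \<mapsto> x t\<^sup>-\<^sup>1\<close> both terms with \<open>x\<^sup>-\<^sup>1\<close> carry \<open>t\<close>, as does \<open>y\<^sup>2\<^sup>\<tau>\<^sup>+\<^sup>1\<close>, and only the
  term with \<open>t\<^sup>-\<^sup>1\<close> is lost in the limit.
\<close>

lemma extremal_limit_plus:
  assumes "c \<noteq> 0"
  shows "extremal_limit 1 (rescale_x 1 (Poly_Mapping.single (e1, e2, e3) c * unknot_dual \<tau>))
    = Poly_Mapping.single (e1 - 1, e2 - 1) c * trinomial ((-1) powi \<tau>) (2 * \<tau> + 2)"
proof -
  let ?\<sigma> = "(-1) powi \<tau> :: rat"
  let ?top = "Poly_Mapping.single (e1 - 1, e2 + 1, e3 - e1 + 1) c
     - Poly_Mapping.single (e1 - 1, e2 - 1, e3 - e1 + 1) c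
     - Poly_Mapping.single (e1, e2 + 2 * \<tau> + 1, e3 - e1 + 1) (c * ?\<sigma>)"
  let ?rest = "Poly_Mapping.single (e1, e2 + 2 * \<tau> - 1, e3 - e1 - 1) (c * ?\<sigma>)"
  have p: "rescale_x 1 (Poly_Mapping.single (e1, e2, e3) c * unknot_dual \<tau>) = ?top + ?rest"
    by (simp add: rescale_x_def unknot_dual_def right_diff_distrib distrib_left mult_single
        monomial_subst_add monomial_subst_diff algebra_simps)
  have "Poly_Mapping.lookup ?top (e1 - 1, e2 + 1, e3 - e1 + 1) = c"
    by (simp add: lookup_minus lookup_single)
  then have nz: "?top \<noteq> 0" using assms by (metis lookup_zero)
  have "extremal_limit 1 (?top + ?rest) = monomial_subst (\<lambda>(i, j, k). (i, j)) ?top"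
  proof (rule extremal_limit_leading_part[OF _ nz, where m = "e3 - e1 + 1"])
    fix i j k assume "(i, j, k) \<in> Poly_Mapping.keys ?top"
    then show "k = e3 - e1 + 1"
      using keys_diff[of "Poly_Mapping.single (e1 - 1, e2 + 1, e3 - e1 + 1) c
          - Poly_Mapping.single (e1 - 1, e2 - 1, e3 - e1 + 1) c"]
        keys_diff[of "Poly_Mapping.single (e1 - 1, e2 + 1, e3 - e1 + 1) c"]
      by (fastforce split: if_splits)
  qed (auto split: if_splits)
  also have "\<dots> = Poly_Mapping.single (e1 - 1, e2 - 1) c * trinomial ?\<sigma> (2 * \<tau> + 2)"
    by (simp add: trinomial_def monomial_subst_add monomial_subst_diff right_diff_distrib mult_single
        single_uminus monomial_subst_minus algebra_simps)
  finally show ?thesis by (simp only: p)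
qed

text \<open>
  After \<open>x \<mapsto> x t\<close> both terms with \<open>x\<^sup>-\<^sup>1\<close> carry \<open>t\<^sup>-\<^sup>1\<close>, as does \<open>y\<^sup>2\<^sup>\<tau>\<^sup>-\<^sup>1\<close>, and only the term
  with \<open>t\<close> is lost in the limit.
\<close>

lemma extremal_limit_minus:
  assumes "c \<noteq> 0"
  shows "extremal_limit (- 1) (rescale_x (- 1) (Poly_Mapping.single (e1, e2, e3) c * unknot_dual \<tau>))
    = Poly_Mapping.single (e1 - 1, e2 - 1) c * trinomial (- ((-1) powi \<tau>)) (2 * \<tau>)"
proof -
  let ?\<sigma> = "(-1) powi \<tau> :: rat"
  let ?top = "Poly_Mapping.single (e1 - 1, e2 + 1, e3 + e1 - 1) c
     - Poly_Mapping.single (e1 - 1, e2 - 1, e3 + e1 - 1) c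
     - Poly_Mapping.single (e1, e2 + 2 * \<tau> - 1, e3 + e1 - 1) (- c * ?\<sigma>)"
  let ?rest = "- Poly_Mapping.single (e1, e2 + 2 * \<tau> + 1, e3 + e1 + 1) (c * ?\<sigma>)"
  have p: "rescale_x (- 1) (Poly_Mapping.single (e1, e2, e3) c * unknot_dual \<tau>) = ?top + ?rest"
    by (simp add: rescale_x_def unknot_dual_def right_diff_distrib distrib_left mult_single single_uminus
        monomial_subst_add monomial_subst_diff algebra_simps)
  have "Poly_Mapping.lookup ?top (e1 - 1, e2 + 1, e3 + e1 - 1) = c"
    by (simp add: lookup_minus lookup_single)
  then have nz: "?top \<noteq> 0" using assms by (metis lookup_zero)
  have "extremal_limit (- 1) (?top + ?rest) = monomial_subst (\<lambda>(i, j, k). (i, j)) ?top"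
  proof (rule extremal_limit_leading_part[OF _ nz, where m = "e3 + e1 - 1"])
    fix i j k assume "(i, j, k) \<in> Poly_Mapping.keys ?top"
    then show "k = e3 + e1 - 1"
      using keys_diff[of "Poly_Mapping.single (e1 - 1, e2 + 1, e3 + e1 - 1) c
          - Poly_Mapping.single (e1 - 1, e2 - 1, e3 + e1 - 1) c"]
        keys_diff[of "Poly_Mapping.single (e1 - 1, e2 + 1, e3 + e1 - 1) c"]
      by (fastforce split: if_splits)
  qed (auto simp flip: single_uminus split: if_splits)
  also have "\<dots> = Poly_Mapping.single (e1 - 1, e2 - 1) c * trinomial (- ?\<sigma>) (2 * \<tau>)"
    by (simp add: trinomial_def monomial_subst_add monomial_subst_diff right_diff_distrib mult_single
        single_uminus monomial_subst_minus algebra_simps)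
  finally show ?thesis by (simp only: p)
qed

section \<open>Specialization at q = 1\<close>

text \<open>
  Putting \<open>s = 1\<close> in a polynomial in \<open>s, t\<close>. The result is placed in the field of Laurent series in
  \<open>t\<close>, where quotients exist and coefficients of powers of \<open>t\<close> can be read off.
\<close>

definition eval_q_half_1 :: "rat poly poly \<Rightarrow> rat fls" where
  "eval_q_half_1 p = fps_to_fls (fps_of_poly (map_poly (\<lambda>c. poly c 1) p))"

lemma eval_q_half_1_add: "eval_q_half_1 (p + q) = eval_q_half_1 p + eval_q_half_1 q"
proof -
  have "map_poly (\<lambda>c. poly c 1) (p + q) = map_poly (\<lambda>c. poly c 1) p + map_poly (\<lambda>c. poly c (1::rat)) q"
    by (rule poly_eqI) (simp add: coeff_map_poly)
  then show ?thesis by (simp add: eval_q_half_1_def fps_of_poly_add)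
qed

lemma eval_q_half_1_mult: "eval_q_half_1 (p * q) = eval_q_half_1 p * eval_q_half_1 q"
proof -
  have "map_poly (\<lambda>c. poly c 1) (p * q) = map_poly (\<lambda>c. poly c 1) p * map_poly (\<lambda>c. poly c (1::rat)) q"
    by (rule poly_eqI) (simp add: coeff_map_poly coeff_mult poly_sum)
  then show ?thesis by (simp add: eval_q_half_1_def fps_of_poly_mult fls_times_fps_to_fls)
qed

lemma eval_q_half_1_0 [simp]: "eval_q_half_1 0 = 0" and eval_q_half_1_1 [simp]: "eval_q_half_1 1 = 1"
  by (simp_all add: eval_q_half_1_def map_poly_1)

lemma eval_q_half_1_minus: "eval_q_half_1 (- p) = - eval_q_half_1 p"
  using eval_q_half_1_add[of p "- p"] by (simp add: eq_neg_iff_add_eq_0 add.commute)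

text \<open>
  The value at \<open>s = 1\<close> of a rational function without a pole there. As a relation it needs no choice
  of a subring, and the rules below derive regularity and value at the same time.
\<close>

definition specializes :: "ratfun \<Rightarrow> rat fls \<Rightarrow> bool" where
  "specializes f g \<longleftrightarrow> (\<exists>p q. eval_q_half_1 q \<noteq> 0 \<and> f = Fract p q \<and> g = eval_q_half_1 p / eval_q_half_1 q)"

lemma specializes_unique:
  assumes "specializes f g" "specializes f g'"
  shows "g = g'"
proof -
  from assms obtain p q p' q' where *: "eval_q_half_1 q \<noteq> 0" "f = Fract p q" "g = eval_q_half_1 p / eval_q_half_1 q"
    "eval_q_half_1 q' \<noteq> 0" "f = Fract p' q'" "g' = eval_q_half_1 p' / eval_q_half_1 q'"
    unfolding specializes_def by blast
  then have "q \<noteq> 0" "q' \<noteq> 0" by auto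
  with * have "p * q' = p' * q" by (simp add: eq_fract)
  then have "eval_q_half_1 p * eval_q_half_1 q' = eval_q_half_1 p' * eval_q_half_1 q" by (metis eval_q_half_1_mult)
  with * show ?thesis by (simp add: frac_eq_eq)
qed

lemma specializes_poly: "specializes (to_fract p) (eval_q_half_1 p)"
  unfolding specializes_def to_fract_def by (intro exI[of _ p] exI[of _ 1]) simp

lemma specializes_add:
  assumes "specializes f g" "specializes f' g'"
  shows "specializes (f + f') (g + g')"
proof -
  from assms obtain p q p' q' where *: "eval_q_half_1 q \<noteq> 0" "f = Fract p q" "g = eval_q_half_1 p / eval_q_half_1 q"
    "eval_q_half_1 q' \<noteq> 0" "f' = Fract p' q'" "g' = eval_q_half_1 p' / eval_q_half_1 q'"
    unfolding specializes_def by blast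
  then have "q \<noteq> 0" "q' \<noteq> 0" by auto
  with * show ?thesis unfolding specializes_def
    by (intro exI[of _ "p * q' + p' * q"] exI[of _ "q * q'"])
      (simp add: eval_q_half_1_mult eval_q_half_1_add add_frac_eq)
qed

lemma specializes_mult:
  assumes "specializes f g" "specializes f' g'"
  shows "specializes (f * f') (g * g')"
proof -
  from assms obtain p q p' q' where *: "eval_q_half_1 q \<noteq> 0" "f = Fract p q" "g = eval_q_half_1 p / eval_q_half_1 q"
    "eval_q_half_1 q' \<noteq> 0" "f' = Fract p' q'" "g' = eval_q_half_1 p' / eval_q_half_1 q'"
    unfolding specializes_def by blast
  then show ?thesis unfolding specializes_def
    by (intro exI[of _ "p * p'"] exI[of _ "q * q'"]) (simp add: eval_q_half_1_mult)
qed

lemma specializes_inverse: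
  assumes "specializes f g" "g \<noteq> 0"
  shows "specializes (inverse f) (inverse g)"
proof -
  from assms obtain p q where *: "eval_q_half_1 q \<noteq> 0" "f = Fract p q" "g = eval_q_half_1 p / eval_q_half_1 q"
    unfolding specializes_def by blast
  then show ?thesis using assms(2) unfolding specializes_def
    by (intro exI[of _ q] exI[of _ p]) simp
qed

lemma specializes_0: "specializes 0 0" and specializes_1: "specializes 1 1"
  using specializes_poly[of 0] specializes_poly[of 1] by simp_all

lemma specializes_minus: "specializes f g \<Longrightarrow> specializes (- f) (- g)"
  using specializes_mult[OF specializes_poly[of "-1"], of f g] by (simp add: eval_q_half_1_minus)

lemma specializes_diff: "specializes f g \<Longrightarrow> specializes f' g' \<Longrightarrow> specializes (f - f') (g - g')"
  using specializes_add[OF _ specializes_minus] by force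

lemma specializes_divide:
  "specializes f g \<Longrightarrow> specializes f' g' \<Longrightarrow> g' \<noteq> 0 \<Longrightarrow> specializes (f / f') (g / g')"
  unfolding divide_inverse by (intro specializes_mult specializes_inverse)

lemma specializes_sum:
  "(\<And>x. x \<in> X \<Longrightarrow> specializes (f x) (g x)) \<Longrightarrow> specializes (sum f X) (sum g X)"
  by (induction X rule: infinite_finite_induct) (auto intro: specializes_0 specializes_add)

lemma specializes_of_nat: "specializes (of_nat n) (of_nat n)"
  by (induction n) (auto intro: specializes_0 specializes_1 specializes_add)

lemma specializes_of_int: "specializes (of_int n) (of_int n)"
  by (cases n) (auto intro!: specializes_of_nat specializes_minus simp del: of_nat_Suc)

lemma specializes_power: "specializes f g \<Longrightarrow> specializes (f ^ n) (g ^ n)"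
  by (induction n) (auto intro: specializes_1 specializes_mult)

lemma specializes_power_int:
  assumes "specializes f g" "g \<noteq> 0"
  shows "specializes (f powi n) (g powi n)"
  using assms by (auto simp: power_int_def intro!: specializes_power specializes_inverse)

lemma specializes_q_half: "specializes q_half 1"
  using specializes_poly[of "[:[:0, 1:]:]"] by (simp add: q_half_def eval_q_half_1_def map_poly_pCons)

lemma specializes_a_half: "specializes a_half fls_X"
  using specializes_poly[of "[:0, 1:]"] by (simp add: a_half_def eval_q_half_1_def map_poly_pCons fps_of_poly_pCons)

lemma specializes_q_half_power_int: "specializes (q_half powi n) 1"
  using specializes_power_int[OF specializes_q_half, of n] by simp

lemma specializes_a_half_power_int: "specializes (a_half powi n) (fls_X powi n)"
  by (rule specializes_power_int[OF specializes_a_half]) simp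

lemma specializes_q_quotient_1: "specializes ((q_half powi a - 1) / (q_half - 1)) (of_int a)"
proof -
  have nz: "q_half - 1 \<noteq> 0"
    using q_half_diff_nz[of 1 0] by simp
  have nat: "specializes ((q_half ^ n - 1) / (q_half - 1)) (of_nat n)" for n
  proof (induction n)
    case (Suc n)
    have "(q_half ^ Suc n - 1) / (q_half - 1) = q_half * ((q_half ^ n - 1) / (q_half - 1)) + 1"
      using nz by (simp add: field_simps)
    then show ?case
      using specializes_add[OF specializes_mult[OF specializes_q_half Suc] specializes_1] by (simp add: add.commute)
  qed (auto intro: specializes_0)
  show ?thesis
  proof (cases "a \<ge> 0")
    case True
    then show ?thesis using nat[of "nat a"] by (simp add: power_int_def)
  next
    case False
    define n where "n = nat (- a)"
    have a: "a = - int n" using False by (simp add: n_def)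
    have "(q_half powi a - 1) / (q_half - 1) = - (q_half powi a * ((q_half ^ n - 1) / (q_half - 1)))"
      using nz by (simp add: a power_int_minus field_simps)
    then show ?thesis
      using specializes_minus[OF specializes_mult[OF specializes_q_half_power_int[of a] nat[of n]]]
      by (simp add: a)
  qed
qed

text \<open>
  The source of all multiplicities: quotients of \<open>q\<close>-differences become quotients of exponents.
\<close>

lemma specializes_q_quotient:
  assumes "d > 0"
  shows "specializes ((q_half powi a - q_half powi b) / (q_half powi d - q_half powi (- d)))
           (of_int (a - b) / of_int (2 * d))"
proof -
  let ?D = "\<lambda>a b. (q_half powi a - 1) / (q_half - 1) - (q_half powi b - 1) / (q_half - 1)"
  have nz: "q_half - 1 \<noteq> 0"
    using q_half_diff_nz[of 1 0] by simp
  have D: "specializes (?D a b) (of_int (a - b))" for a b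
    using specializes_diff[OF specializes_q_quotient_1 specializes_q_quotient_1, of a b] by simp
  have eq: "?D a b = (q_half powi a - q_half powi b) / (q_half - 1)" for a b
    by (simp add: diff_divide_distrib)
  have "specializes (?D a b / ?D d (- d)) (of_int (a - b) / of_int (d - - d))"
    using assms by (intro specializes_divide D) (simp del: of_int_add of_int_diff)
  then show ?thesis using nz by (simp add: eq)
qed

text \<open>
  Solving \<open>x Q' = E Q\<close> coefficient by coefficient uses only ring operations and division by positive
  integers. If \<open>E\<close> is regular at \<open>s = 1\<close>, then so is \<open>Q\<close>, and its value solves the specialized
  equation.
\<close>

lemma log_deriv_specializes:
  assumes Q: "fps_X * fps_deriv Q = E * Q" "Q $ 0 = 1" "E $ 0 = 0"
    and spec: "\<And>n. specializes (E $ n) (e $ n)"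
  obtains g where "g $ 0 = 1" "fps_X * fps_deriv g = e * g" "\<And>n. specializes (Q $ n) (g $ n)"
proof -
  have e0: "e $ 0 = 0" using spec[of 0] Q(3) specializes_0 specializes_unique by metis
  have rec: "of_nat n * (Q $ n) = (\<Sum>i=1..n. E $ i * Q $ (n - i))" for n
  proof -
    have "of_nat n * (Q $ n) = (E * Q) $ n" by (simp flip: Q(1) fps_X_mult_deriv_nth)
    also have "\<dots> = (\<Sum>i=1..n. E $ i * Q $ (n - i))"
      unfolding fps_mult_nth using Q(3) by (simp add: sum.atLeast_Suc_atMost)
    finally show ?thesis .
  qed
  have "\<exists>x. specializes (Q $ n) x" for n
  proof (induction n rule: less_induct)
    case (less n)
    show ?case
    proof (cases "n = 0")
      case True
      then show ?thesis using Q(2) specializes_1 by auto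
    next
      case False
      from less obtain h where h: "\<And>k. k < n \<Longrightarrow> specializes (Q $ k) (h k)" by metis
      have "specializes (\<Sum>i=1..n. E $ i * Q $ (n - i)) (\<Sum>i=1..n. e $ i * h (n - i))"
        by (intro specializes_sum specializes_mult spec h) auto
      then have "specializes ((\<Sum>i=1..n. E $ i * Q $ (n - i)) / of_nat n) ((\<Sum>i=1..n. e $ i * h (n - i)) / of_nat n)"
        using False by (intro specializes_divide specializes_of_nat) auto
      moreover have "Q $ n = (\<Sum>i=1..n. E $ i * Q $ (n - i)) / of_nat n"
        using rec[of n] False by (simp add: field_simps)
      ultimately show ?thesis by auto
    qed
  qed
  then obtain h where h: "\<And>n. specializes (Q $ n) (h n)" by metis
  define g where "g = Abs_fps h"
  have g: "specializes (Q $ n) (g $ n)" for n using h by (simp add: g_def)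
  have "fps_X * fps_deriv g = e * g"
  proof (rule fps_ext)
    fix n
    have "specializes (of_nat n * (Q $ n)) (of_nat n * (g $ n))"
      by (intro specializes_mult specializes_of_nat g)
    moreover have "specializes (of_nat n * (Q $ n)) (\<Sum>i=1..n. e $ i * g $ (n - i))"
      unfolding rec by (intro specializes_sum specializes_mult spec g)
    ultimately have "of_nat n * (g $ n) = (\<Sum>i=1..n. e $ i * g $ (n - i))" by (rule specializes_unique)
    also have "\<dots> = (e * g) $ n"
      unfolding fps_mult_nth using e0 by (simp add: sum.atLeast_Suc_atMost)
    finally show "(fps_X * fps_deriv g) $ n = (e * g) $ n" by (simp only: fps_X_mult_deriv_nth)
  qed
  moreover have "g $ 0 = 1" using g[of 0] Q(2) specializes_1 specializes_unique by metis
  ultimately show ?thesis using g that by blast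
qed

section \<open>The Adams operations\<close>

lemma adams_poly_add: "adams_poly d (p + p') = adams_poly d p + adams_poly d p'"
proof -
  have "map_poly (\<lambda>c. pcompose c (monom 1 d)) (p + p') =
    map_poly (\<lambda>c. pcompose c (monom 1 d)) p + map_poly (\<lambda>c. pcompose c (monom (1::rat) d)) p'"
    by (rule poly_eqI) (simp add: coeff_map_poly pcompose_add)
  then show ?thesis by (simp add: adams_poly_def pcompose_add)
qed

lemma adams_add:
  assumes "d \<ge> 1"
  shows "adams d (f + g) = adams d f + adams d g"
proof (cases f; cases g)
  fix p q p' q' assume "f = Fract p q" "q \<noteq> 0" "g = Fract p' q'" "q' \<noteq> 0"
  then show ?thesis using assms
    by (simp add: adams_Fract adams_poly_add adams_poly_mult adams_poly_eq_0_iff)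
qed

lemma adams_mult:
  assumes "d \<ge> 1"
  shows "adams d (f * g) = adams d f * adams d g"
proof (cases f; cases g)
  fix p q p' q' assume "f = Fract p q" "q \<noteq> 0" "g = Fract p' q'" "q' \<noteq> 0"
  then show ?thesis using assms by (simp add: adams_Fract adams_poly_mult)
qed

lemma adams_to_fract:
  assumes "d \<ge> 1"
  shows "adams d (to_fract p) = to_fract (adams_poly d p)"
proof -
  have "adams_poly d 1 = 1" by (simp add: adams_poly_def map_poly_1 pcompose_1 flip: one_pCons)
  then show ?thesis using assms by (simp add: to_fract_def adams_Fract)
qed

lemma adams_1: "d \<ge> 1 \<Longrightarrow> adams d 1 = 1"
  using adams_to_fract[of d 1] by (simp add: adams_poly_def map_poly_1 pcompose_1 flip: one_pCons)

lemma adams_0: "d \<ge> 1 \<Longrightarrow> adams d 0 = 0"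
  using adams_to_fract[of d 0] by (simp add: adams_poly_def)

lemma adams_minus: "d \<ge> 1 \<Longrightarrow> adams d (- f) = - adams d f"
  using adams_add[of d f "- f"] adams_0[of d] by (simp add: eq_neg_iff_add_eq_0 add.commute)

lemma adams_inverse:
  assumes "d \<ge> 1"
  shows "adams d (inverse f) = inverse (adams d f)"
proof (cases "f = 0")
  case False
  then have "adams d f * adams d (inverse f) = 1"
    using adams_mult[OF assms, of f "inverse f"] adams_1[OF assms] by simp
  then show ?thesis by (metis inverse_unique)
qed (use assms in \<open>simp add: adams_0\<close>)

lemma adams_power: "d \<ge> 1 \<Longrightarrow> adams d (f ^ n) = adams d f ^ n"
  by (induction n) (simp_all add: adams_1 adams_mult)

lemma adams_power_int: "d \<ge> 1 \<Longrightarrow> adams d (f powi n) = adams d f powi n"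
  by (simp add: power_int_def adams_power adams_inverse)

lemma adams_sum: "d \<ge> 1 \<Longrightarrow> adams d (sum f X) = (\<Sum>x\<in>X. adams d (f x))"
  by (induction X rule: infinite_finite_induct) (simp_all add: adams_0 adams_add)

lemma adams_of_nat: "d \<ge> 1 \<Longrightarrow> adams d (of_nat n) = of_nat n"
  by (induction n) (simp_all add: adams_0 adams_1 adams_add)

lemma adams_of_int: "d \<ge> 1 \<Longrightarrow> adams d (of_int n) = of_int n"
  by (cases n) (simp_all add: adams_of_nat adams_minus del: of_nat_Suc)

lemma adams_q_half: "d \<ge> 1 \<Longrightarrow> adams d q_half = q_half ^ d"
proof -
  have "[:[:0, 1:]:] ^ d = [:monom (1::rat) d:]"
    by (induction d) (simp_all add: monom_Suc)
  then show "d \<ge> 1 \<Longrightarrow> adams d q_half = q_half ^ d"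
    by (simp add: q_half_def adams_to_fract adams_poly_def map_poly_pCons pcompose_pCons flip: to_fract_power)
qed

lemma adams_a_half: "d \<ge> 1 \<Longrightarrow> adams d a_half = a_half ^ d"
proof -
  have "[:0, 1:] ^ d = monom (1 :: rat poly) d"
    by (induction d) (simp_all add: monom_Suc)
  then show "d \<ge> 1 \<Longrightarrow> adams d a_half = a_half ^ d"
    by (simp add: a_half_def adams_to_fract adams_poly_def map_poly_pCons pcompose_pCons pcompose_1 flip: to_fract_power)
qed

section \<open>The generating series of the BPS invariants\<close>

lemma formal_sum_nth: "formal_sum F $ n = (\<Sum>r=1..n. F r $ n)"
  by (simp add: formal_sum_def)

text \<open>
  The pole of \<open>f\<^sub>r(a\<^sup>d, q\<^sup>d)\<close> at \<open>s = 1\<close> is at most the simple pole of \<open>1 / (s\<^sup>d - s\<^sup>-\<^sup>d)\<close>, and it is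
  cancelled by a difference of two powers of \<open>s\<close>.
\<close>

lemma specializes_BPS_term:
  assumes OV: "Ooguri_Vafa_form f N" and r: "r \<ge> 1" and d: "d \<ge> 1"
  shows "specializes (adams d (f r) * (q_half powi a - q_half powi b))
     (of_int (a - b) / of_int (2 * int d) *
      (\<Sum>(i, j) | N r i j \<noteq> 0. of_int (N r i j) * fls_X powi (i * int d)))"
proof -
  let ?S = "{(i, j). N r i j \<noteq> 0}"
  have f: "f r = (\<Sum>(i, j)\<in>?S. of_int (N r i j) * a_half powi i * q_half powi j / (q_half - inverse q_half))"
    using OV r by (simp add: Ooguri_Vafa_form_def)
  have den: "adams d (q_half - inverse q_half) = q_half powi int d - q_half powi (- int d)"
    using adams_add[OF d, of q_half "- inverse q_half"] d
    by (simp add: adams_minus adams_inverse adams_q_half power_int_minus)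
  have "adams d (f r) * (q_half powi a - q_half powi b) =
    (\<Sum>(i, j)\<in>?S. of_int (N r i j) * a_half powi (i * int d) * q_half powi (j * int d) *
       ((q_half powi a - q_half powi b) / (q_half powi int d - q_half powi (- int d))))"
    unfolding f using d
    by (simp add: adams_sum case_prod_unfold divide_inverse adams_mult adams_inverse den adams_of_int
        adams_power_int adams_a_half adams_q_half sum_distrib_right sum_distrib_left mult_ac
        power_int_mult[symmetric] flip: power_int_of_nat)
  moreover have "specializes (\<Sum>(i, j)\<in>?S. of_int (N r i j) * a_half powi (i * int d) * q_half powi (j * int d) *
       ((q_half powi a - q_half powi b) / (q_half powi int d - q_half powi (- int d))))
     (\<Sum>(i, j)\<in>?S. of_int (N r i j) * fls_X powi (i * int d) * 1 * (of_int (a - b) / of_int (2 * int d)))"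
    unfolding case_prod_unfold using d
    by (intro specializes_sum specializes_mult specializes_of_int specializes_a_half_power_int
        specializes_q_half_power_int specializes_q_quotient) simp
  ultimately show ?thesis by (simp add: sum_distrib_left case_prod_unfold mult_ac)
qed

text \<open>
  The logarithmic derivative of the limit of \<open>Z(s x) / Z(s\<^sup>-\<^sup>1 x)\<close> for \<open>s \<rightarrow> 1\<close>, where \<open>Z\<close> is the
  generating series of the invariants. Its coefficients are Laurent polynomials in \<open>t\<close>, written in
  the variable of Laurent series.
\<close>

definition BPS_log_deriv :: "(nat \<Rightarrow> int \<Rightarrow> int \<Rightarrow> int) \<Rightarrow> rat fls fps" where
  "BPS_log_deriv N = Abs_fps (\<lambda>n. if n = 0 then 0 else
     (\<Sum>r | r dvd n. of_nat r ^ 2 *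
       (\<Sum>(i, j) | N r i j \<noteq> 0. of_int (N r i j) * fls_X powi (i * int (n div r)))))"

text \<open>
  The series \<open>Z(s\<^sup>2\<^sup>m\<^sup>-\<^sup>1 x) / Z(s\<^sup>-\<^sup>1 x)\<close> has a logarithmic derivative that is regular at \<open>s = 1\<close>, with
  value proportional to \<open>m\<close>: so it specializes to the \<open>m\<close>-th power of the case \<open>m = 1\<close>.
\<close>

lemma specializes_log_deriv:
  assumes OV: "Ooguri_Vafa_form f N"
  defines "F \<equiv> formal_sum (\<lambda>d. formal_sum (\<lambda>r. fps_const (1 / of_nat d * adams d (f r)) * fps_X ^ (r * d)))"
  shows "specializes ((dilate (q_half powi (2 * m - 1)) (fps_X * fps_deriv F) - dilate (q_half powi (- 1)) (fps_X * fps_deriv F)) $ n)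
           ((fps_const (of_int m) * BPS_log_deriv N) $ n)"
proof (cases "n = 0")
  case True
  then show ?thesis by (simp add: BPS_log_deriv_def specializes_0)
next
  case False
  have F: "of_nat n * (F $ n) = (\<Sum>r | r dvd n. of_nat r * adams (n div r) (f r))"
  proof -
    have "F $ n = (\<Sum>d=1..n. \<Sum>r=1..n. if r * d = n then 1 / of_nat d * adams d (f r) else 0)"
      unfolding F_def formal_sum_nth fps_mult_left_const_nth fps_X_power_nth
      by (intro sum.cong refl) auto
    also have "\<dots> = (\<Sum>r | r dvd n. 1 / of_nat (n div r) * adams (n div r) (f r))"
      using False by (intro sum_divisor_pairs) simp
    finally have "of_nat n * (F $ n) = (\<Sum>r | r dvd n. of_nat n * (1 / of_nat (n div r) * adams (n div r) (f r)))"
      by (simp only: sum_distrib_left)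
    also have "\<dots> = (\<Sum>r | r dvd n. of_nat r * adams (n div r) (f r))"
      using False by (intro sum.cong refl) (auto elim!: dvdE simp: field_simps)
    finally show ?thesis .
  qed
  have "(dilate (q_half powi (2 * m - 1)) (fps_X * fps_deriv F) - dilate (q_half powi (- 1)) (fps_X * fps_deriv F)) $ n
     = (of_nat n * (F $ n)) * (q_half powi ((2 * m - 1) * int n) - q_half powi (- int n))"
    by (simp only: fps_sub_nth dilate_nth fps_X_mult_deriv_nth)
      (simp add: power_int_power' power_int_minus power_inverse algebra_simps)
  also have "\<dots> = (\<Sum>r | r dvd n. of_nat r * (adams (n div r) (f r) * (q_half powi ((2 * m - 1) * int n) - q_half powi (- int n))))"
    by (simp only: F sum_distrib_right mult.assoc)
  finally have 1: "(dilate (q_half powi (2 * m - 1)) (fps_X * fps_deriv F) - dilate (q_half powi (- 1)) (fps_X * fps_deriv F)) $ n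
     = (\<Sum>r | r dvd n. of_nat r * (adams (n div r) (f r) * (q_half powi ((2 * m - 1) * int n) - q_half powi (- int n))))" .
  have 2: "(fps_const (of_int m) * BPS_log_deriv N) $ n =
    (\<Sum>r | r dvd n. of_nat r * (of_int ((2 * m - 1) * int n - - int n) / of_int (2 * int (n div r)) *
      (\<Sum>(i, j) | N r i j \<noteq> 0. of_int (N r i j) * fls_X powi (i * int (n div r)))))"
  proof -
    have "of_int m * (of_nat r ^ 2 * x) = of_nat r * (of_int ((2 * m - 1) * int n - - int n) / of_int (2 * int (n div r)) * x)"
      if "r dvd n" for r and x :: "rat fls"
      using that False by (auto elim!: dvdE simp: field_simps power2_eq_square)
    then show ?thesis using False
      by (simp add: BPS_log_deriv_def sum_distrib_left[of "of_int m"])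
  qed
  show ?thesis
    unfolding 1 2
    by (intro specializes_sum specializes_mult specializes_of_nat specializes_BPS_term[OF OV])
      (use False in \<open>auto simp: Suc_le_eq div_greater_zero_iff dvd_pos_nat dest: dvd_imp_le\<close>)
qed

text \<open>
  Multiplying the recursion by \<open>x\<^sup>n\<^sup>+\<^sup>1\<close> and summing gives
  \<open>Z(s x) - Z(s\<^sup>-\<^sup>1 x) = (-1)\<^sup>\<tau> x (t Z(s\<^sup>2\<^sup>\<tau>\<^sup>+\<^sup>1 x) - t\<^sup>-\<^sup>1 Z(s\<^sup>2\<^sup>\<tau>\<^sup>-\<^sup>1 x))\<close>. Dividing by \<open>Z(s\<^sup>-\<^sup>1 x)\<close> and
  putting \<open>s = 1\<close> yields \<open>Y - 1 = (-1)\<^sup>\<tau> x (t Y\<^sup>\<tau>\<^sup>+\<^sup>1 - t\<^sup>-\<^sup>1 Y\<^sup>\<tau>)\<close> for the limit \<open>Y\<close> of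
  \<open>Z(s x) / Z(s\<^sup>-\<^sup>1 x)\<close>. This equation is of Lagrange type in \<open>W = Y - 1\<close>.
\<close>

lemma BPS_log_deriv_lagrange:
  assumes f: "BPS_functions \<tau> f" and OV: "Ooguri_Vafa_form f N"
  defines "\<phi> \<equiv> fps_const ((-1) powi \<tau>) * (fps_const fls_X * fps_binomial (of_int (\<tau> + 1))
        - fps_const (inverse fls_X) * fps_binomial (of_int \<tau>))"
  shows "BPS_log_deriv N $ Suc n = (fps_binomial (-1) * \<phi> ^ Suc n) $ n"
proof -
  define F where "F = formal_sum (\<lambda>d. formal_sum (\<lambda>r. fps_const (1 / of_nat d * adams d (f r)) * fps_X ^ (r * d)))"
  define Z where "Z = Abs_fps (framed_H \<tau>)"
  have F0: "F $ 0 = 0" by (simp add: F_def formal_sum_def)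
  have Z: "Z = fps_exp 1 oo F" using f by (simp add: BPS_functions_def Z_def F_def)
  have Z0: "Z $ 0 = 1" by (simp add: Z)
  have DZ: "fps_X * fps_deriv Z = (fps_X * fps_deriv F) * Z" unfolding Z by (rule log_deriv_exp[OF F0])
  let ?B = "dilate (q_half powi (- 1)) Z"
  define Q where "Q m = dilate (q_half powi (2 * m - 1)) Z * inverse ?B" for m :: int
  let ?E = "\<lambda>m :: int. dilate (q_half powi (2 * m - 1)) (fps_X * fps_deriv F) - dilate (q_half powi (- 1)) (fps_X * fps_deriv F)"
  let ?e = "BPS_log_deriv N"
  have B0: "?B $ 0 \<noteq> 0" by (simp add: Z0)
  have "\<exists>g. g $ 0 = 1 \<and> fps_X * fps_deriv g = fps_const (of_int m) * ?e * g \<and> (\<forall>n. specializes (Q m $ n) (g $ n))" for m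
  proof -
    have "fps_X * fps_deriv (Q m) = ?E m * Q m"
      unfolding Q_def by (intro log_deriv_divide log_deriv_dilate DZ B0)
    moreover have "Q m $ 0 = 1" by (simp add: Q_def Z0)
    moreover have "?E m $ 0 = 0" by simp
    moreover have "specializes (?E m $ n) ((fps_const (of_int m) * ?e) $ n)" for n
      unfolding F_def by (rule specializes_log_deriv[OF OV])
    ultimately show ?thesis by (rule log_deriv_specializes) blast
  qed
  then obtain g where g: "\<And>m. g m $ 0 = 1" "\<And>m. fps_X * fps_deriv (g m) = fps_const (of_int m) * ?e * g m"
    "\<And>m n. specializes (Q m $ n) (g m $ n)" by metis
  \<comment> \<open>The series \<open>g m\<close> is the value of \<open>Q m\<close> at \<open>s = 1\<close>; comparing logarithmic derivatives will show that it is \<open>(1 + W)\<^sup>m\<close>.\<close>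
  define W where "W = g 1 - 1"
  have W0: "W $ 0 = 0" by (simp add: W_def g)
  have DW: "fps_X * fps_deriv W * inverse (1 + W) = ?e"
  proof -
    have "fps_X * fps_deriv W * inverse (1 + W) = ?e * ((1 + W) * inverse (1 + W))"
      using g(2)[of 1] by (simp add: W_def mult.assoc)
    then show ?thesis using W0 by (simp add: inverse_mult_eq_1')
  qed
  have gB: "g m = fps_binomial (of_int m) oo W" for m
  proof (rule log_deriv_unique[OF g(2)])
    show "fps_X * fps_deriv (fps_binomial (of_int m) oo W) = fps_const (of_int m) * ?e * (fps_binomial (of_int m) oo W)"
      unfolding log_deriv_binomial_compose[OF W0] DW ..
  qed (simp_all add: g BPS_log_deriv_def)
  have rec: "Q 1 - 1 = fps_const ((-1) powi \<tau>) * (fps_X * (fps_const a_half * Q (\<tau> + 1) - fps_const (inverse a_half) * Q \<tau>))"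
  proof -
    have "dilate (q_half powi (2 * 1 - 1)) Z - ?B = fps_const ((-1) powi \<tau>) * (fps_X *
        (fps_const a_half * dilate (q_half powi (2 * (\<tau> + 1) - 1)) Z
        - fps_const (inverse a_half) * dilate (q_half powi (2 * \<tau> - 1)) Z))"
    proof (rule fps_ext)
      fix n
      show "(dilate (q_half powi (2 * 1 - 1)) Z - ?B) $ n = (fps_const ((-1) powi \<tau>) * (fps_X *
        (fps_const a_half * dilate (q_half powi (2 * (\<tau> + 1) - 1)) Z
        - fps_const (inverse a_half) * dilate (q_half powi (2 * \<tau> - 1)) Z))) $ n"
      proof (cases n)
        case (Suc k)
        have *: "(q_half powi (2 * j - 1)) ^ k = q_half powi (2 * int k * j) * q_half powi (- int k)" for j
        proof -
          have "(2 * j - 1) * int k = 2 * int k * j + - int k" by (simp add: algebra_simps)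
          then have "(q_half powi (2 * j - 1)) ^ k = q_half powi (2 * int k * j + - int k)"
            by (simp only: power_int_power' )
          then show ?thesis by (simp only: power_int_add[OF disjI1[OF q_half_nz]])
        qed
        have "2 * int k * (\<tau> + 1) + - int k = 2 * int k * \<tau> + int k" by (simp add: algebra_simps)
        then have **: "(q_half powi (2 * (\<tau> + 1) - 1)) ^ k = q_half powi (2 * int k * \<tau>) * q_half powi int k"
          unfolding * power_int_add[OF disjI1[OF q_half_nz], symmetric] by (simp only:)
        have "(dilate (q_half powi (2 * 1 - 1)) Z - ?B) $ n =
            (q_half powi (int k + 1) - q_half powi (- (int k + 1))) * framed_H \<tau> (Suc k)"
          by (simp add: Suc Z_def power_int_add power_int_minus power_int_diff power_inverse field_simps)
        also have "\<dots> = (-1) powi \<tau> * (a_half * ((q_half powi (2 * (\<tau> + 1) - 1)) ^ k * framed_H \<tau> k)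
            - inverse a_half * ((q_half powi (2 * \<tau> - 1)) ^ k * framed_H \<tau> k))"
          unfolding framed_H_Suc ** *[of \<tau>] by (simp only: algebra_simps)
        also have "\<dots> = (fps_const ((-1) powi \<tau>) * (fps_X *
          (fps_const a_half * dilate (q_half powi (2 * (\<tau> + 1) - 1)) Z
          - fps_const (inverse a_half) * dilate (q_half powi (2 * \<tau> - 1)) Z))) $ n"
          by (simp add: Suc Z_def)
        finally show ?thesis .
      qed (simp add: Z0)
    qed
    then have "(dilate (q_half powi (2 * 1 - 1)) Z - ?B) * inverse ?B = fps_const ((-1) powi \<tau>) * (fps_X *
        (fps_const a_half * dilate (q_half powi (2 * (\<tau> + 1) - 1)) Z
        - fps_const (inverse a_half) * dilate (q_half powi (2 * \<tau> - 1)) Z)) * inverse ?B"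
      by (simp only:)
    moreover have "(dilate (q_half powi (2 * 1 - 1)) Z - ?B) * inverse ?B = Q 1 - 1"
      using inverse_mult_eq_1'[OF B0] by (simp add: Q_def left_diff_distrib)
    ultimately show ?thesis by (simp only: Q_def left_diff_distrib mult.assoc)
  qed
  have W: "W = fps_X * (\<phi> oo W)"
  proof -
    have "W = fps_const ((-1) powi \<tau>) * (fps_X * (fps_const fls_X * g (\<tau> + 1) - fps_const (inverse fls_X) * g \<tau>))"
    proof (rule fps_ext)
      fix n
      have sign: "specializes ((-1) powi \<tau>) ((-1) powi \<tau>)"
        using specializes_power_int[OF specializes_minus[OF specializes_1]] by simp
      have "specializes ((Q 1 - 1) $ n) (W $ n)"
        unfolding W_def fps_sub_nth
        by (intro specializes_diff g) (auto intro: specializes_0 specializes_1)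
      moreover have "specializes ((Q 1 - 1) $ n)
         ((fps_const ((-1) powi \<tau>) * (fps_X * (fps_const fls_X * g (\<tau> + 1) - fps_const (inverse fls_X) * g \<tau>))) $ n)"
        unfolding rec
        by (cases n) (auto intro!: specializes_mult specializes_diff specializes_0 sign g
            specializes_a_half specializes_inverse)
      ultimately show "W $ n = (fps_const ((-1) powi \<tau>) * (fps_X * (fps_const fls_X * g (\<tau> + 1) - fps_const (inverse fls_X) * g \<tau>))) $ n"
        by (rule specializes_unique)
    qed
    also have "\<dots> = fps_X * (\<phi> oo W)"
      using W0 unfolding gB \<phi>_def
      by (simp add: fps_compose_mult_distrib fps_compose_sub_distrib mult_ac)
    finally show ?thesis .
  qed
  have "\<phi> $ 0 \<noteq> 0"
  proof -
    have "fls_X - inverse fls_X \<noteq> (0 :: rat fls)"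
    proof
      assume "fls_X - inverse fls_X = (0 :: rat fls)"
      then have "(fls_X - inverse fls_X :: rat fls) $$ 1 = 0" by simp
      then show False by (simp add: fls_inverse_X)
    qed
    then show ?thesis by (simp add: \<phi>_def)
  qed
  from log_deriv_lagrange[OF this W, of n] show ?thesis unfolding DW .
qed

lemma of_int_int_binomial: "(of_int (int_binomial n k) :: 'a::field_char_0) = of_int n gchoose k"
proof (cases "n < 0")
  case True
  have "(of_int n :: 'a) gchoose k = (-1) ^ k * ((of_nat k - of_int n - 1) gchoose k)"
    by (rule gbinomial_negated_upper)
  also have "of_nat k - of_int n - 1 = (of_nat (nat (- n + int k - 1)) :: 'a)"
    using True by (simp add: of_nat_nat)
  finally show ?thesis using True by (simp add: int_binomial_def binomial_gbinomial)
next
  case False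
  then have "of_int n = (of_nat (nat n) :: 'a)" by simp
  then show ?thesis using False by (simp only: int_binomial_def binomial_gbinomial if_False of_int_of_nat_eq)
qed

text \<open>
  With \<open>\<phi> = (-1)\<^sup>\<tau> (1 + x)\<^sup>\<tau> (t (1 + x) - t\<^sup>-\<^sup>1)\<close>, expand the \<open>n\<close>-th power of the last factor by the
  binomial theorem. The powers of \<open>t\<close> range from \<open>t\<^sup>n\<close> to \<open>t\<^sup>-\<^sup>n\<close>.
\<close>

lemma BPS_log_deriv_explicit:
  assumes "BPS_functions \<tau> f" "Ooguri_Vafa_form f N" and n: "n \<ge> 1"
  shows "BPS_log_deriv N $ n = (\<Sum>k\<le>n. fls_const (((-1) powi \<tau>) ^ n * of_nat (n choose k) * (-1) ^ k
      * of_int (int_binomial (int n * \<tau> + int n - int k - 1) (n - 1))) * fls_X powi (int n - 2 * int k))"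
proof -
  obtain m where m: "n = Suc m" using n by (cases n) auto
  let ?\<sigma> = "(-1) powi \<tau> :: rat fls"
  let ?b = "\<lambda>c. fps_binomial c :: rat fls fps"
  have \<sigma>: "fls_const ((-1) powi \<tau>) = ?\<sigma>"
    by (simp add: power_int_minus_left)
  have \<phi>: "fps_const ?\<sigma> * (fps_const fls_X * ?b (of_int (\<tau> + 1)) - fps_const (inverse fls_X) * ?b (of_int \<tau>))
      = fps_const ?\<sigma> * (?b (of_int \<tau>) * (fps_const (- inverse fls_X) + fps_const fls_X * ?b 1))"
    by (simp add: fps_binomial_add_mult algebra_simps flip: fps_const_neg)
  have bb: "?b (-1) * (C * (?b x * ?b y)) = C * ?b (x + y - 1)" for C x y
    using fps_binomial_add_mult[of "x + y" "-1"] fps_binomial_add_mult[of x y] by (simp add: mult_ac)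
  have "(fps_const ?\<sigma> * (?b (of_int \<tau>) * (fps_const (- inverse fls_X) + fps_const fls_X * ?b 1))) ^ n
    = fps_const (?\<sigma> ^ n) * (?b (of_nat n * of_int \<tau>) *
       (\<Sum>k\<le>n. of_nat (n choose k) * fps_const (- inverse fls_X) ^ k * (fps_const fls_X * ?b 1) ^ (n - k)))"
    by (simp add: power_mult_distrib binomial_ring fps_binomial_power)
  also have "\<dots> = (\<Sum>k\<le>n. fps_const (?\<sigma> ^ n * of_nat (n choose k) * (- inverse fls_X) ^ k * fls_X ^ (n - k))
       * (?b (of_nat n * of_int \<tau>) * ?b (of_nat (n - k))))"
    by (simp add: sum_distrib_left power_mult_distrib fps_binomial_power fps_of_nat mult_ac
        flip: fps_const_mult)
  finally have pw: "?b (-1) * (fps_const ?\<sigma> * (?b (of_int \<tau>) * (fps_const (- inverse fls_X) + fps_const fls_X * ?b 1))) ^ n =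
    (\<Sum>k\<le>n. fps_const (?\<sigma> ^ n * of_nat (n choose k) * (- inverse fls_X) ^ k * fls_X ^ (n - k))
       * ?b (of_nat n * of_int \<tau> + of_nat (n - k) - 1))"
    by (simp only: sum_distrib_left bb)
  have "BPS_log_deriv N $ n = (\<Sum>k\<le>n. (?\<sigma> ^ n * of_nat (n choose k) * (- inverse fls_X) ^ k * fls_X ^ (n - k))
       * ((of_nat n * of_int \<tau> + of_nat (n - k) - 1) gchoose (n - 1)))"
    using BPS_log_deriv_lagrange[OF assms(1,2), of m] pw[unfolded \<phi>[symmetric]]
    unfolding \<phi> by (simp add: m fps_sum_nth)
  also have "\<dots> = (\<Sum>k\<le>n. fls_const (((-1) powi \<tau>) ^ n * of_nat (n choose k) * (-1) ^ k
      * of_int (int_binomial (int n * \<tau> + int n - int k - 1) (n - 1))) * fls_X powi (int n - 2 * int k))"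
  proof (intro sum.cong refl)
    fix k assume k: "k \<in> {..n}"
    have x: "(- inverse fls_X) ^ k * fls_X ^ (n - k) = (-1) ^ k * (fls_X powi (int n - 2 * int k) :: rat fls)"
    proof -
      have "int n - 2 * int k = int (n - k) + - int k" using k by simp
      then have "(fls_X powi (int n - 2 * int k) :: rat fls) = fls_X ^ (n - k) * inverse fls_X ^ k"
        by (simp only: power_int_add[OF disjI1[OF fls_X_nonzero]] power_int_minus power_int_of_nat power_inverse)
      then show ?thesis by (simp only: power_minus[of "inverse fls_X"] mult_ac)
    qed
    have i: "of_nat n * of_int \<tau> + of_nat (n - k) - 1 = (of_int (int n * \<tau> + int n - int k - 1) :: rat fls)"
      using k by (simp add: of_nat_diff)
    have e: "fls_const (((-1) powi \<tau>) ^ n * of_nat (n choose k) * (-1) ^ k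
        * of_int (int_binomial (int n * \<tau> + int n - int k - 1) (n - 1)))
      = ?\<sigma> ^ n * of_nat (n choose k) * (-1) ^ k * of_int (int_binomial (int n * \<tau> + int n - int k - 1) (n - 1))"
    proof -
      have "(-1 :: rat fls) ^ k = fls_const ((-1) ^ k)" by (simp add: fls_const_power)
      then show ?thesis
        by (simp only: fls_of_nat fls_of_int \<sigma>[symmetric] fls_const_power[symmetric] fls_const_mult_const)
    qed
    show "(?\<sigma> ^ n * of_nat (n choose k) * (- inverse fls_X) ^ k * fls_X ^ (n - k))
       * ((of_nat n * of_int \<tau> + of_nat (n - k) - 1) gchoose (n - 1)) =
      fls_const (((-1) powi \<tau>) ^ n * of_nat (n choose k) * (-1) ^ k
        * of_int (int_binomial (int n * \<tau> + int n - int k - 1) (n - 1))) * fls_X powi (int n - 2 * int k)"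
      unfolding i of_int_int_binomial[symmetric] e mult.assoc[of _ _ "fls_X ^ (n - k)"] x by (simp only: mult_ac)
  qed
  finally show ?thesis .
qed

lemma sum_bps:
  assumes "finite {(i, j). N r i j \<noteq> 0}"
  shows "(\<Sum>(i, j) | N r i j \<noteq> 0. if i = i0 then of_int (N r i j) else 0) = (of_int (bps N r i0) :: 'a::ring_1)"
proof -
  let ?S = "{(i, j). N r i j \<noteq> 0}"
  have "(\<Sum>(i, j)\<in>?S. if i = i0 then of_int (N r i j) else 0) = (\<Sum>(i, j)\<in>{e \<in> ?S. fst e = i0}. (of_int (N r i j) :: 'a))"
    using assms by (subst sum.inter_filter) (auto intro!: sum.cong)
  also have "\<dots> = (\<Sum>j | N r i0 j \<noteq> 0. of_int (N r i0 j))"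
    by (rule sum.reindex_bij_witness[where i = "\<lambda>j. (i0, j)" and j = snd]) auto
  finally show ?thesis by (simp add: bps_def)
qed

text \<open>
  In the \<open>n\<close>-th coefficient the function \<open>f\<^sub>r\<close> occurs through \<open>t\<^sup>i\<^sup>n\<^sup>/\<^sup>r\<close>, so the power \<open>t\<^sup>n\<^sup>c\<close> selects
  \<open>i = r c\<close>, the extremal invariants for \<open>c = \<plusminus> 1\<close>.
\<close>

lemma nth_BPS_log_deriv:
  assumes OV: "Ooguri_Vafa_form f N" and n: "n \<ge> 1"
  shows "BPS_log_deriv N $ n $$ (int n * c) = (\<Sum>r | r dvd n. of_nat r ^ 2 * of_int (extremal_BPS N c r))"
proof -
  have 1: "(of_nat r ^ 2 * x) $$ k = of_nat r ^ 2 * x $$ k" for r k and x :: "rat fls"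
    by (simp add: fls_of_nat flip: fls_const_power)
  have 2: "(of_int z * fls_X powi i) $$ k = (if i = k then of_int z else (0 :: rat))" for z i k
    by (simp add: fls_of_int)
  have "BPS_log_deriv N $ n $$ (int n * c) = (\<Sum>r | r dvd n. of_nat r ^ 2 *
      (\<Sum>(i, j) | N r i j \<noteq> 0. if i * int (n div r) = int n * c then of_int (N r i j) else 0))"
    using n by (simp add: BPS_log_deriv_def fls_nth_sum 1 2 case_prod_unfold)
      (auto intro!: sum.cong)
  also have "\<dots> = (\<Sum>r | r dvd n. of_nat r ^ 2 *
      (\<Sum>(i, j) | N r i j \<noteq> 0. if i = int r * c then of_int (N r i j) else 0))"
  proof (intro sum.cong refl arg_cong2[where f = "(*)"])
    fix r x assume "r \<in> {r. r dvd n}"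
    then obtain k where k: "n = r * k" by auto
    have "i * int (n div r) = int n * c \<longleftrightarrow> i = int r * c" for i
      using n k by auto
    then show "(case x of (i, j) \<Rightarrow> if i * int (n div r) = int n * c then of_int (N r i j) else 0) =
        (case x of (i, j) \<Rightarrow> if i = int r * c then of_int (N r i j) else (0 :: rat))"
      by simp
  qed
  also have "\<dots> = (\<Sum>r | r dvd n. of_nat r ^ 2 * of_int (extremal_BPS N c r))"
    using n OV unfolding extremal_BPS_def
    by (intro sum.cong refl arg_cong2[where f = "(*)"] sum_bps)
      (auto simp: Ooguri_Vafa_form_def Suc_le_eq intro: dvd_pos_nat)
  finally show ?thesis .
qed

text \<open>
  The powers \<open>t\<^sup>n\<close> and \<open>t\<^sup>-\<^sup>n\<close> are the two ends, \<open>k = 0\<close> and \<open>k = n\<close>, of the binomial expansion.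
\<close>

lemma extremal_BPS_divisor_sum:
  assumes BPS: "BPS_invariants \<tau> N" and n: "n \<ge> 1"
  shows "(\<Sum>r | r dvd n. of_nat r ^ 2 * of_int (extremal_BPS N 1 r)) =
      ((-1) powi \<tau>) ^ n * (of_int (int_binomial (int n * (\<tau> + 1) - 1) (n - 1)) :: rat)"
    and "(\<Sum>r | r dvd n. of_nat r ^ 2 * of_int (extremal_BPS N (- 1) r)) =
      (- ((-1) powi \<tau>)) ^ n * (of_int (int_binomial (int n * \<tau> - 1) (n - 1)) :: rat)"
proof -
  obtain f where f: "BPS_functions \<tau> f" "Ooguri_Vafa_form f N"
    using BPS by (auto simp: BPS_invariants_def)
  have nth: "(\<Sum>r | r dvd n. of_nat r ^ 2 * of_int (extremal_BPS N c r)) =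
      (\<Sum>k\<le>n. if int n - 2 * int k = int n * c then ((-1) powi \<tau>) ^ n * of_nat (n choose k) * (-1) ^ k
      * of_int (int_binomial (int n * \<tau> + int n - int k - 1) (n - 1)) else (0 :: rat))" for c
    unfolding nth_BPS_log_deriv[OF f(2) n, symmetric] BPS_log_deriv_explicit[OF f n] fls_nth_sum
    by (intro sum.cong refl) simp
  have "(\<Sum>r | r dvd n. of_nat r ^ 2 * of_int (extremal_BPS N 1 r)) =
     (\<Sum>k\<le>n. if k = 0 then ((-1) powi \<tau>) ^ n * (of_int (int_binomial (int n * (\<tau> + 1) - 1) (n - 1)) :: rat) else 0)"
    unfolding nth by (intro sum.cong refl) (simp add: algebra_simps)
  then show "(\<Sum>r | r dvd n. of_nat r ^ 2 * of_int (extremal_BPS N 1 r)) =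
      ((-1) powi \<tau>) ^ n * (of_int (int_binomial (int n * (\<tau> + 1) - 1) (n - 1)) :: rat)"
    by simp
  have "(\<Sum>r | r dvd n. of_nat r ^ 2 * of_int (extremal_BPS N (- 1) r)) =
     (\<Sum>k\<le>n. if k = n then (- ((-1) powi \<tau>)) ^ n * (of_int (int_binomial (int n * \<tau> - 1) (n - 1)) :: rat) else 0)"
    unfolding nth by (intro sum.cong refl) (auto simp: power_minus[of "(-1) powi \<tau>"])
  then show "(\<Sum>r | r dvd n. of_nat r ^ 2 * of_int (extremal_BPS N (- 1) r)) =
      (- ((-1) powi \<tau>)) ^ n * (of_int (int_binomial (int n * \<tau> - 1) (n - 1)) :: rat)"
    by simp
qed

section \<open>Extremal A-polynomials\<close>

lemma eval_at_lin_ext: "eval_at P y = lin_ext (\<lambda>(i, j) c. fls_const c * fls_X powi i * fps_to_fls y powi j) P"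
  by (simp add: eval_at_def lin_ext_def case_prod_unfold)

lemma eval_at_add: "eval_at (P + P') y = eval_at P y + eval_at P' y"
  unfolding eval_at_lin_ext
  by (rule lin_ext_add) (auto simp: distrib_right simp flip: fls_plus_const)

lemma eval_at_mult: "y \<noteq> 0 \<Longrightarrow> eval_at (P * P') y = eval_at P y * eval_at P' y"
  unfolding eval_at_lin_ext
  by (rule lin_ext_mult) (auto simp: distrib_right power_int_add simp flip: fls_plus_const fls_const_mult_const simp del: fls_X_power_int)

lemma eval_at_single: "eval_at (Poly_Mapping.single (i, j) c) y = fls_const c * fls_X powi i * fps_to_fls y powi j"
  unfolding eval_at_lin_ext by (subst lin_ext_single) auto

lemma eval_at_diff: "eval_at (P - P') y = eval_at P y - eval_at P' y"
  using eval_at_add[of "P - P'" P' y] by (simp add: algebra_simps)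

lemma eval_at_trinomial:
  "eval_at (trinomial \<sigma> m) y = fps_to_fls y ^ 2 - 1 - fls_const \<sigma> * fls_X * fps_to_fls y powi m"
  using eval_at_single[of 0 0 1 y]
  by (simp add: trinomial_def eval_at_diff eval_at_single power_int_def flip: zero_prod_def)

text \<open>
  The divisor sums are the coefficients that Lagrange inversion gives to the logarithmic derivative
  of \<open>1 + W\<close>, where \<open>W = \<sigma> x (1 + W)\<^sup>m\<close>. The defining equation of \<open>y\<close> asks for half of it, so
  \<open>y = (1 + W)\<^sup>1\<^sup>/\<^sup>2\<close>, and the equation for \<open>W\<close> says that \<open>(x, y)\<close> is a zero of
  \<open>y\<^sup>2 - 1 - \<sigma> x y\<^sup>2\<^sup>m\<close>.
\<close>

lemma exists_extremal_y:
  fixes \<sigma> :: rat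
  assumes "\<sigma> \<noteq> 0" and \<beta>: "\<And>n. n \<ge> 1 \<Longrightarrow> (\<Sum>r | r dvd n. of_nat r ^ 2 * of_int (\<beta> r)) =
      \<sigma> ^ n * (of_int (int_binomial (int n * m - 1) (n - 1)) :: rat)"
  shows "\<exists>y. is_extremal_y \<beta> y \<and> eval_at (trinomial \<sigma> (2 * m)) y = 0"
proof -
  define \<phi> where "\<phi> = fps_const \<sigma> * fps_binomial (of_int m)"
  have \<phi>0: "\<phi> $ 0 \<noteq> 0" using assms(1) by (simp add: \<phi>_def)
  obtain W where W: "W = fps_X * (\<phi> oo W)" using exists_lagrange_series[OF \<phi>0] by blast
  have W0: "W $ 0 = 0" by (subst W) simp
  \<comment> \<open>\<open>E\<close> is the logarithmic derivative of \<open>1 + W\<close>, twice that of \<open>y\<close>.\<close>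
  define y where "y = fps_binomial (1 / 2) oo W"
  define E where "E = fps_X * fps_deriv W * inverse (1 + W)"
  have E: "E $ n = (\<Sum>r=1..n. if r dvd n then of_nat r ^ 2 * of_int (\<beta> r) else 0)" for n
  proof (cases n)
    case (Suc k)
    have "E $ n = (fps_binomial (-1) * \<phi> ^ n) $ k"
      unfolding E_def Suc by (rule log_deriv_lagrange[OF \<phi>0 W])
    also have "fps_binomial (-1) * \<phi> ^ n = fps_const (\<sigma> ^ n) * fps_binomial (of_nat n * of_int m + (- 1))"
      by (simp only: fps_binomial_add_mult) (simp add: \<phi>_def power_mult_distrib fps_binomial_power fps_const_power mult_ac)
    also have "\<dots> $ k = \<sigma> ^ n * of_int (int_binomial (int n * m - 1) (n - 1))"
      by (simp add: of_int_int_binomial Suc)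
    also have "\<dots> = (\<Sum>r | r dvd n. of_nat r ^ 2 * of_int (\<beta> r))"
      using Suc by (intro \<beta>[symmetric]) simp
    also have "\<dots> = (\<Sum>r=1..n. if r dvd n then of_nat r ^ 2 * of_int (\<beta> r) else 0)"
      using Suc by (subst sum.inter_filter[symmetric])
        (auto intro!: sum.cong dest: dvd_imp_le simp: Suc_le_eq intro: Nat.gr0I)
    finally show ?thesis .
  qed (simp add: E_def)
  have "is_extremal_y \<beta> y"
    unfolding is_extremal_y_def
  proof
    show y0: "y $ 0 = 1" by (simp add: y_def)
    have "fps_X * fps_deriv y / y = fps_const (1 / 2) * E * (y * inverse y)"
      using y0 log_deriv_binomial_compose[OF W0, of "1 / 2"]
      by (simp add: fps_divide_unit y_def E_def mult.assoc)
    also have "\<dots> = fps_const (1 / 2) * E" using y0 by (simp add: inverse_mult_eq_1')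
    also have "E = formal_sum (\<lambda>r. fps_const (of_nat r ^ 2 * of_int (\<beta> r)) * fps_X ^ r / (1 - fps_X ^ r))"
    proof (rule fps_ext)
      fix n
      have geo: "(fps_const c * fps_X ^ r / (1 - fps_X ^ r)) $ n = (if r dvd n then c else 0)"
        if "r \<in> {1..n}" for r and c :: rat
        using that by (simp add: lambert_term_nth)
      show "E $ n = formal_sum (\<lambda>r. fps_const (of_nat r ^ 2 * of_int (\<beta> r)) * fps_X ^ r / (1 - fps_X ^ r)) $ n"
        unfolding E formal_sum_nth using geo by (intro sum.cong refl) auto
    qed
    finally show "fps_X * fps_deriv y / y = fps_const (1 / 2) *
        formal_sum (\<lambda>r. fps_const (of_nat r ^ 2 * of_int (\<beta> r)) * fps_X ^ r / (1 - fps_X ^ r))" .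
  qed
  moreover have "eval_at (trinomial \<sigma> (2 * m)) y = 0"
  proof -
    have "fps_to_fls y ^ 2 = 1 + fps_to_fls W"
      using fps_binomial_half_power_int[OF W0, of 2] W0
      by (simp add: y_def power_int_def fps_binomial_1 fps_compose_add_distrib)
    moreover have "fps_to_fls y powi (2 * m) = fps_to_fls (fps_binomial (of_int m) oo W)"
      using fps_binomial_half_power_int[OF W0, of "2 * m"] by (simp add: y_def)
    moreover have "fps_to_fls W = fls_const \<sigma> * fls_X * fps_to_fls (fps_binomial (of_int m) oo W)"
      by (subst W) (simp add: \<phi>_def fps_compose_mult_distrib[OF W0] fls_times_fps_to_fls mult_ac)
    ultimately show ?thesis by (simp add: eval_at_trinomial)
  qed
  ultimately show ?thesis by blast
qed

text \<open>
  When the limit is itself irreducible, it is up to units its only irreducible factor, and the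
  condition on \<open>y\<close> holds for it automatically.
\<close>

lemma extremal_A_polynomial_iff:
  assumes limit: "\<And>e1 e2 e3 d. d \<noteq> 0 \<Longrightarrow>
      extremal_limit c (rescale_x c (Poly_Mapping.single (e1, e2, e3) d * unknot_dual \<tau>))
      = Poly_Mapping.single (e1 - 1, e2 - 1) d * trinomial \<sigma> m"
    and \<sigma>: "\<sigma> \<noteq> 0"
    and y: "is_extremal_y (extremal_BPS N c) y" "eval_at (trinomial \<sigma> m) y = 0"
  shows "extremal_A_polynomial \<tau> N c P \<longleftrightarrow> monomial_equiv P (trinomial \<sigma> m)"
proof
  assume "extremal_A_polynomial \<tau> N c P"
  then obtain D where D: "dual_A_polynomial \<tau> D" and P: "irreducible P" "P dvd extremal_limit c (rescale_x c D)"
    unfolding extremal_A_polynomial_def by blast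
  from D obtain e d where d: "d \<noteq> 0" and D: "D = Poly_Mapping.single e d * unknot_dual \<tau>"
    unfolding dual_A_polynomial_iff monomial_equiv_def by blast
  obtain e1 e2 e3 where e: "e = (e1, e2, e3)" by (cases e)
  let ?T = "Poly_Mapping.single (e1 - 1, e2 - 1) d * trinomial \<sigma> m"
  obtain R where R: "?T = P * R" using P(2) by (auto simp: D e limit[OF d])
  have "irreducible ?T"
    by (intro irreducible_unit_mult monomial_dvd_1 irreducible_trinomial d \<sigma>)
  then have "R dvd 1" using R P(1) by (metis irreducible_def)
  then obtain R' where R': "R * R' = 1" by (metis dvdE)
  then have "R' * R = 1" by (simp add: mult.commute)
  from laurent_unit_is_monomial[OF this] obtain e' d' where d': "d' \<noteq> 0" "R' = Poly_Mapping.single e' d'" by blast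
  have "P = ?T * R'" unfolding R by (simp add: mult.assoc R')
  also have "\<dots> = Poly_Mapping.single ((e1 - 1, e2 - 1) + e') (d * d') * trinomial \<sigma> m"
    unfolding d' mult_single[symmetric] by (simp only: mult_ac)
  finally show "monomial_equiv P (trinomial \<sigma> m)"
    unfolding monomial_equiv_def using d d' by (metis mult_eq_0_iff)
next
  assume "monomial_equiv P (trinomial \<sigma> m)"
  then obtain e d where d: "d \<noteq> 0" and P: "P = Poly_Mapping.single e d * trinomial \<sigma> m"
    unfolding monomial_equiv_def by blast
  obtain i j where e: "e = (i, j)" by (cases e)
  let ?D = "Poly_Mapping.single (i + 1, j + 1, 0) d * unknot_dual \<tau>"
  have "dual_A_polynomial \<tau> ?D" unfolding dual_A_polynomial_iff monomial_equiv_def using d by blast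
  moreover have "irreducible P"
    unfolding P by (intro irreducible_unit_mult monomial_dvd_1 irreducible_trinomial d \<sigma>)
  moreover have "P dvd extremal_limit c (rescale_x c ?D)"
    unfolding limit[OF d] P e by simp
  moreover have "eval_at P y = 0"
  proof -
    have "y \<noteq> 0" using y(1) by (auto simp: is_extremal_y_def)
    then show ?thesis by (simp add: P eval_at_mult y(2))
  qed
  ultimately show "extremal_A_polynomial \<tau> N c P" unfolding extremal_A_polynomial_def using y(1) by blast
qed

lemma monomial_equiv_scale:
  assumes "c \<noteq> 0"
  shows "monomial_equiv P (lconst c * Q) \<longleftrightarrow> monomial_equiv P Q"
proof
  assume "monomial_equiv P (lconst c * Q)"
  then obtain d e where "d \<noteq> 0" "P = Poly_Mapping.single e d * (lconst c * Q)"
    unfolding monomial_equiv_def by blast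
  moreover from this have "P = Poly_Mapping.single e (d * c) * Q"
    by (simp add: lconst_def mult_single flip: mult.assoc zero_prod_def)
  ultimately show "monomial_equiv P Q" unfolding monomial_equiv_def using assms by (metis mult_eq_0_iff)
next
  assume "monomial_equiv P Q"
  then obtain d e where d: "d \<noteq> 0" "P = Poly_Mapping.single e d * Q"
    unfolding monomial_equiv_def by blast
  then have "P = Poly_Mapping.single e (d / c) * (lconst c * Q)"
    using assms by (simp add: lconst_def mult_single flip: mult.assoc zero_prod_def)
  moreover have "d / c \<noteq> 0" using assms d by simp
  ultimately show "monomial_equiv P (lconst c * Q)" unfolding monomial_equiv_def by blast
qed

theorem proposition1p2:
  fixes \<tau> :: int and N :: "nat \<Rightarrow> int \<Rightarrow> int \<Rightarrow> int"
  assumes "BPS_invariants \<tau> N"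
  shows
    "(\<forall>P. extremal_A_polynomial \<tau> N 1 P \<longleftrightarrow>
        monomial_equiv P
          (lconst ((-1) powi \<tau>) * (ypow 2 - 1) - xpow 1 * ypow (2 * \<tau> + 2))) \<and>
     (\<forall>P. extremal_A_polynomial \<tau> N (- 1) P \<longleftrightarrow>
        monomial_equiv P
          (lconst ((-1) powi \<tau>) * (ypow 2 - 1) + xpow 1 * ypow (2 * \<tau>))) \<and>
     (\<forall>r\<ge>1. rat_of_int (extremal_BPS N 1 r) =
        1 / of_nat r ^ 2 *
        (\<Sum>d | d dvd r. of_int (mobius (r div d)) * (-1) powi (int d * \<tau>) *
           of_int (int_binomial (int d * (\<tau> + 1) - 1) (d - 1)))) \<and>
     (\<forall>r\<ge>1. rat_of_int (extremal_BPS N (- 1) r) =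
        1 / of_nat r ^ 2 *
        (\<Sum>d | d dvd r. of_int (mobius (r div d)) * (-1) powi (int d * (\<tau> + 1)) *
           of_int (int_binomial (int d * \<tau> - 1) (d - 1))))"
proof (intro conjI allI impI)
  let ?\<sigma> = "(-1) powi \<tau> :: rat"
  have \<sigma>: "?\<sigma> \<noteq> 0" "- ?\<sigma> \<noteq> 0" "?\<sigma> * ?\<sigma> = 1"
    by (simp_all flip: power_int_mult_distrib)
  note plus = extremal_BPS_divisor_sum(1)[OF assms]
  note minus = extremal_BPS_divisor_sum(2)[OF assms]
  fix P
  obtain y where y: "is_extremal_y (extremal_BPS N 1) y" "eval_at (trinomial ?\<sigma> (2 * (\<tau> + 1))) y = 0"
    using exists_extremal_y[OF \<sigma>(1) plus] by blast
  have "lconst ?\<sigma> * (ypow 2 - 1) - xpow 1 * ypow (2 * \<tau> + 2) = lconst ?\<sigma> * trinomial ?\<sigma> (2 * \<tau> + 2)"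
    using \<sigma>(3) by (simp add: lconst_def ypow_def xpow_def trinomial_def right_diff_distrib mult_single)
  then show "extremal_A_polynomial \<tau> N 1 P \<longleftrightarrow>
        monomial_equiv P (lconst ((-1) powi \<tau>) * (ypow 2 - 1) - xpow 1 * ypow (2 * \<tau> + 2))"
    using extremal_A_polynomial_iff[OF extremal_limit_plus \<sigma>(1), of N y P] y
    by (simp add: monomial_equiv_scale)
  obtain z where z: "is_extremal_y (extremal_BPS N (- 1)) z" "eval_at (trinomial (- ?\<sigma>) (2 * \<tau>)) z = 0"
    using exists_extremal_y[OF \<sigma>(2) minus] by blast
  have "lconst ?\<sigma> * (ypow 2 - 1) + xpow 1 * ypow (2 * \<tau>) = lconst ?\<sigma> * trinomial (- ?\<sigma>) (2 * \<tau>)"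
    using \<sigma>(3) by (simp add: lconst_def ypow_def xpow_def trinomial_def right_diff_distrib distrib_left mult_single single_uminus)
  then show "extremal_A_polynomial \<tau> N (- 1) P \<longleftrightarrow>
        monomial_equiv P (lconst ((-1) powi \<tau>) * (ypow 2 - 1) + xpow 1 * ypow (2 * \<tau>))"
    using extremal_A_polynomial_iff[OF extremal_limit_minus \<sigma>(2), of N z P] z
    by (simp add: monomial_equiv_scale)
next
  fix r :: nat assume r: "r \<ge> 1"
  have sign: "((-1) powi \<tau>) ^ d = ((-1) powi (int d * \<tau>) :: rat)"
    "(- ((-1) powi \<tau>)) ^ d = ((-1) powi (int d * (\<tau> + 1)) :: rat)" for d
  proof -
    show "((-1) powi \<tau>) ^ d = ((-1) powi (int d * \<tau>) :: rat)" 
      by (simp add: power_int_power' mult.commute)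
    have "- ((-1) powi \<tau>) = ((-1) powi (\<tau> + 1) :: rat)" by (simp add: power_int_add)
    then show "(- ((-1) powi \<tau>)) ^ d = ((-1) powi (int d * (\<tau> + 1)) :: rat)"
      by (simp only: power_int_power' mult.commute)
  qed
  show "rat_of_int (extremal_BPS N 1 r) = 1 / of_nat r ^ 2 *
        (\<Sum>d | d dvd r. of_int (mobius (r div d)) * (-1) powi (int d * \<tau>) *
           of_int (int_binomial (int d * (\<tau> + 1) - 1) (d - 1)))"
    using mobius_divide_square[OF extremal_BPS_divisor_sum(1)[OF assms] r] unfolding sign by (simp only: mult.assoc)
  show "rat_of_int (extremal_BPS N (- 1) r) = 1 / of_nat r ^ 2 *
        (\<Sum>d | d dvd r. of_int (mobius (r div d)) * (-1) powi (int d * (\<tau> + 1)) *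
           of_int (int_binomial (int d * \<tau> - 1) (d - 1)))"
    using mobius_divide_square[OF extremal_BPS_divisor_sum(2)[OF assms] r] unfolding sign by (simp only: mult.assoc)
qed

end
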